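(* For every integer $m \geq 2$, the variety $\mathbf{R}_m \vee \mathbf{L}_m$ is strictly contained in $\mathbf{R}_{m+1} \cap \mathbf{L}_{m+1}$, i.e. $\mathbf{R}_m \vee \mathbf{L}_m \subsetneq \mathbf{R}_{m+1} \cap \mathbf{L}_{m+1}$.
   Context: A variety is a class of finite monoids closed under submonoids, homomorphic images and finite direct products. The join $\mathbf{V} \vee \mathbf{W}$ of two varieties is the smallest variety containing both. For a finite monoid $M$ and $x,y\in M$: $x \mathrel{\mathcal{R}} y$ iff $xM = yM$, and $x \mathrel{\mathcal{L}} y$ iff $Mx = My$. Define congruences on $M$: $x \sim_K y$ iff for all idempotents $e$ of $M$, if $ex \mathrel{\mathcal{R}} e$ or $ey \mathrel{\mathcal{R}} e$, then $ex = ey$; and $x \sim_D y$ iff for all idempotents $e$ of $M$, if $xe \mathrel{\mathcal{L}} e$ or $ye \mathrel{\mathcal{L}} e$, then $xe = ye$. For a variety $\mathbf{V}$, let $\mathbf{K} ⓜ \mathbf{V}$ be the class of all finite monoids $M$ with $M/{\sim_K} \in \mathbf{V}$, and $\mathbf{D} ⓜ \mathbf{V}$ the class of all finite monoids $M$ with $M/{\sim_D} \in \mathbf{V}$. The Trotter-Weil hierarchy: $\mathbf{R}_2$ is the variety of $\mathcal{R}$-trivial finite monoids (those in which $\mathcal{R}$ is equality), $\mathbf{L}_2$ is the variety of $\mathcal{L}$-trivial finite monoids, and for $m \geq 2$, $\mathbf{R}_{m+1} = \mathbf{K} ⓜ \mathbf{L}_m$ and $\mathbf{L}_{m+1} = \mathbf{D}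 ⓜ \mathbf{R}_m$. Each of these is a variety. *)

theory Defs
  imports "HOL-Algebra.Product_Groups"
begin

section \<open>Varieties of finite monoids\<close>

text \<open>A class of finite monoids is represented by the set of its members whose elements are
  natural numbers. No monoid is lost: every finite monoid has an isomorphic copy of this kind
  (see \<open>finite_monoid_nat_copy\<close> below), and the classes considered here are closed under
  isomorphism. A monoid over any other type belongs to the class iff it is isomorphic to a
  member of the set.\<close>

definition fin_monoids :: "nat monoid set" where
  "fin_monoids = {M. monoid M \<and> finite (carrier M)}"

definition belongs_to :: "'a monoid \<Rightarrow> nat monoid set \<Rightarrow> bool" where
  "belongs_to M V \<longleftrightarrow> (\<exists>N\<in>V. M \<cong> N)"

lemma finite_monoid_nat_copy:
  fixes M :: "'a monoid"
  assumes "monoid M" "finite (carrier M)"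
  shows "belongs_to M fin_monoids"
proof -
  interpret monoid M by fact
  obtain f :: "'a \<Rightarrow> nat" where inj: "inj_on f (carrier M)"
    using finite_imp_inj_to_nat_seg[OF assms(2)] by (elim exE conjE)
  define g where "g = inv_into (carrier M) f"
  have g: "g (f x) = x" if "x \<in> carrier M" for x
    using that inj by (simp add: g_def)
  define N where
    "N = \<lparr>carrier = f ` carrier M, mult = (\<lambda>a b. f (g a \<otimes>\<^bsub>M\<^esub> g b)), one = f \<one>\<^bsub>M\<^esub>\<rparr>"
  have "monoid N"
    by (rule monoidI) (auto simp: N_def g m_assoc)
  moreover have "finite (carrier N)"
    using assms(2) by (simp add: N_def)
  moreover have "f \<in> iso M N"
    using inj by (auto simp: iso_def hom_def bij_betw_def N_def g)
  ultimately show ?thesis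
    unfolding belongs_to_def fin_monoids_def using is_isoI by blast
qed

text \<open>The trivial monoid is the empty direct product (\<open>n = 0\<close>), so varieties are nonempty.
  A surjective semigroup homomorphism between monoids preserves the unit, so \<open>epi\<close> describes
  the surjective monoid homomorphisms.\<close>

definition variety :: "nat monoid set \<Rightarrow> bool" where
  "variety V \<longleftrightarrow>
     V \<subseteq> fin_monoids \<and>
     (\<forall>M\<in>V. \<forall>H. submonoid H M \<longrightarrow> M\<lparr>carrier := H\<rparr> \<in> V) \<and>
     (\<forall>M\<in>V. \<forall>N\<in>fin_monoids. epi M N \<noteq> {} \<longrightarrow> N \<in> V) \<and>
     (\<forall>(n::nat) M. (\<forall>i<n. M i \<in> V) \<longrightarrow> belongs_to (product_group {..<n} M) V)"

definition variety_join :: "nat monoid set \<Rightarrow> nat monoid set \<Rightarrow> nat monoid set" where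
  "variety_join V W = \<Inter>{U. variety U \<and> V \<subseteq> U \<and> W \<subseteq> U}"


section \<open>Green's relations and the congruences \<open>\<sim>\<^sub>K\<close> and \<open>\<sim>\<^sub>D\<close>\<close>

definition green_R :: "'a monoid \<Rightarrow> 'a \<Rightarrow> 'a \<Rightarrow> bool" where
  "green_R M x y \<longleftrightarrow> x <#\<^bsub>M\<^esub> carrier M = y <#\<^bsub>M\<^esub> carrier M"

definition green_L :: "'a monoid \<Rightarrow> 'a \<Rightarrow> 'a \<Rightarrow> bool" where
  "green_L M x y \<longleftrightarrow> carrier M #>\<^bsub>M\<^esub> x = carrier M #>\<^bsub>M\<^esub> y"

definition idempotents :: "'a monoid \<Rightarrow> 'a set" where
  "idempotents M = {e \<in> carrier M. e \<otimes>\<^bsub>M\<^esub> e = e}"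

definition sim_K :: "'a monoid \<Rightarrow> ('a \<times> 'a) set" where
  "sim_K M = {(x, y) \<in> carrier M \<times> carrier M. \<forall>e\<in>idempotents M.
      green_R M (e \<otimes>\<^bsub>M\<^esub> x) e \<or> green_R M (e \<otimes>\<^bsub>M\<^esub> y) e \<longrightarrow> e \<otimes>\<^bsub>M\<^esub> x = e \<otimes>\<^bsub>M\<^esub> y}"

definition sim_D :: "'a monoid \<Rightarrow> ('a \<times> 'a) set" where
  "sim_D M = {(x, y) \<in> carrier M \<times> carrier M. \<forall>e\<in>idempotents M.
      green_L M (x \<otimes>\<^bsub>M\<^esub> e) e \<or> green_L M (y \<otimes>\<^bsub>M\<^esub> e) e \<longrightarrow> x \<otimes>\<^bsub>M\<^esub> e = y \<otimes>\<^bsub>M\<^esub> e}"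

text \<open>For a congruence \<open>r\<close>, all products of an element of a class \<open>X\<close> with an element of a class
  \<open>Y\<close> lie in a single class, and that class is \<open>r `` (X <#> Y)\<close>; see \<open>quotient_monoid_mult\<close>.\<close>

definition quotient_monoid :: "'a monoid \<Rightarrow> ('a \<times> 'a) set \<Rightarrow> 'a set monoid" where
  "quotient_monoid M r =
     \<lparr>carrier = carrier M // r, mult = (\<lambda>X Y. r `` (X <#>\<^bsub>M\<^esub> Y)), one = r `` {\<one>\<^bsub>M\<^esub>}\<rparr>"

definition monoid_congruence :: "'a monoid \<Rightarrow> ('a \<times> 'a) set \<Rightarrow> bool" where
  "monoid_congruence M r \<longleftrightarrow> equiv (carrier M) r \<and>
     (\<forall>(x, y)\<in>r. \<forall>z\<in>carrier M. (x \<otimes>\<^bsub>M\<^esub> z, y \<otimes>\<^bsub>M\<^esub> z) \<in> r \<and> (z \<otimes>\<^bsub>M\<^esub> x, z \<otimes>\<^bsub>M\<^esub> y) \<in> r)"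

lemma quotient_monoid_mult:
  assumes "monoid M" "monoid_congruence M r" "x \<in> carrier M" "y \<in> carrier M"
  shows "(r `` {x}) \<otimes>\<^bsub>quotient_monoid M r\<^esub> (r `` {y}) = r `` {x \<otimes>\<^bsub>M\<^esub> y}"
proof -
  interpret monoid M by fact
  have eq: "equiv (carrier M) r"
    and cong: "\<And>a b z. (a, b) \<in> r \<Longrightarrow> z \<in> carrier M \<Longrightarrow>
      (a \<otimes>\<^bsub>M\<^esub> z, b \<otimes>\<^bsub>M\<^esub> z) \<in> r \<and> (z \<otimes>\<^bsub>M\<^esub> a, z \<otimes>\<^bsub>M\<^esub> b) \<in> r"
    using assms(2) unfolding monoid_congruence_def by auto
  have carr: "a \<in> carrier M" "b \<in> carrier M" if "(a, b) \<in> r" for a b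
    using that equiv_type[OF eq] by auto
  have refl: "(x, x) \<in> r" "(y, y) \<in> r"
    using eq assms(3,4) by (auto simp: equiv_def refl_on_def)
  have tr: "(a, c) \<in> r" if "(a, b) \<in> r" "(b, c) \<in> r" for a b c
    using that eq by (auto simp: equiv_def dest: transD)
  have "(x \<otimes>\<^bsub>M\<^esub> y, a \<otimes>\<^bsub>M\<^esub> b) \<in> r" if "(x, a) \<in> r" "(y, b) \<in> r" for a b
    using that cong[of x a y] cong[of y b a] carr assms(4) tr by blast
  then have "r `` ((r `` {x}) <#>\<^bsub>M\<^esub> (r `` {y})) \<subseteq> r `` {x \<otimes>\<^bsub>M\<^esub> y}"
    unfolding set_mult_def using tr by blast
  moreover have "r `` {x \<otimes>\<^bsub>M\<^esub> y} \<subseteq> r `` ((r `` {x}) <#>\<^bsub>M\<^esub> (r `` {y}))"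
    unfolding set_mult_def using refl by blast
  ultimately show ?thesis
    unfolding quotient_monoid_def by simp
qed

lemma green_R_idem_iff:
  assumes "monoid M" "e \<in> carrier M" "x \<in> carrier M"
  shows "green_R M (e \<otimes>\<^bsub>M\<^esub> x) e \<longleftrightarrow> (\<exists>w\<in>carrier M. e \<otimes>\<^bsub>M\<^esub> x \<otimes>\<^bsub>M\<^esub> w = e)" (is "?l \<longleftrightarrow> ?r")
proof -
  interpret monoid M by fact
  show ?thesis
  proof
    assume ?l
    moreover have "e \<in> e <#\<^bsub>M\<^esub> carrier M"
      using assms(2) unfolding l_coset_def by (force intro: bexI[of _ "\<one>\<^bsub>M\<^esub>"])
    ultimately have "e \<in> (e \<otimes>\<^bsub>M\<^esub> x) <#\<^bsub>M\<^esub> carrier M"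
      by (simp add: green_R_def)
    then obtain w where "w \<in> carrier M" "e = e \<otimes>\<^bsub>M\<^esub> x \<otimes>\<^bsub>M\<^esub> w"
      by (auto simp: l_coset_def)
    then show ?r by metis
  next
    assume ?r
    then obtain w where w: "w \<in> carrier M" "e \<otimes>\<^bsub>M\<^esub> x \<otimes>\<^bsub>M\<^esub> w = e" by blast
    have "e \<otimes>\<^bsub>M\<^esub> x \<otimes>\<^bsub>M\<^esub> h \<in> e <#\<^bsub>M\<^esub> carrier M" if "h \<in> carrier M" for h
      using that assms m_assoc[of e x h] unfolding l_coset_def by blast
    moreover have "e \<otimes>\<^bsub>M\<^esub> h \<in> (e \<otimes>\<^bsub>M\<^esub> x) <#\<^bsub>M\<^esub> carrier M" if "h \<in> carrier M" for h
    proof -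
      have "e \<otimes>\<^bsub>M\<^esub> h = e \<otimes>\<^bsub>M\<^esub> x \<otimes>\<^bsub>M\<^esub> (w \<otimes>\<^bsub>M\<^esub> h)"
        using that assms w m_assoc[of "e \<otimes>\<^bsub>M\<^esub> x" w h] by simp
      then show ?thesis using that w unfolding l_coset_def by blast
    qed
    ultimately show ?l unfolding green_R_def l_coset_def by blast
  qed
qed

lemma sim_K_carrier: "(x, y) \<in> sim_K M \<Longrightarrow> x \<in> carrier M \<and> y \<in> carrier M"
  unfolding sim_K_def by blast

lemma sim_KD:
  "(x, y) \<in> sim_K M \<Longrightarrow> e \<in> idempotents M \<Longrightarrow>
    green_R M (e \<otimes>\<^bsub>M\<^esub> x) e \<or> green_R M (e \<otimes>\<^bsub>M\<^esub> y) e \<Longrightarrow> e \<otimes>\<^bsub>M\<^esub> x = e \<otimes>\<^bsub>M\<^esub> y"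
  unfolding sim_K_def by blast

lemma sim_KI:
  assumes "x \<in> carrier M" "y \<in> carrier M"
    and "\<And>e. e \<in> idempotents M \<Longrightarrow>
      green_R M (e \<otimes>\<^bsub>M\<^esub> x) e \<or> green_R M (e \<otimes>\<^bsub>M\<^esub> y) e \<Longrightarrow> e \<otimes>\<^bsub>M\<^esub> x = e \<otimes>\<^bsub>M\<^esub> y"
  shows "(x, y) \<in> sim_K M"
  using assms unfolding sim_K_def by blast

lemma sim_K_congruence:
  assumes "monoid M"
  shows "monoid_congruence M (sim_K M)"
proof -
  interpret monoid M by fact
  have "equiv (carrier M) (sim_K M)"
  proof (rule equivI)
    show "sim_K M \<subseteq> carrier M \<times> carrier M"
      using sim_K_carrier by fast
    show "refl_on (carrier M) (sim_K M)"
      by (rule refl_onI) (simp add: sim_K_def)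
    show "sym (sim_K M)"
    proof (rule symI)
      fix x y assume xy: "(x, y) \<in> sim_K M"
      then show "(y, x) \<in> sim_K M"
        using sim_K_carrier[OF xy] sim_KD[OF xy, symmetric] by (intro sim_KI) blast+
    qed
    show "trans (sim_K M)"
    proof (rule transI)
      fix x y z assume xy: "(x, y) \<in> sim_K M" and yz: "(y, z) \<in> sim_K M"
      show "(x, z) \<in> sim_K M"
      proof (rule sim_KI)
        show "x \<in> carrier M" "z \<in> carrier M"
          using sim_K_carrier xy yz by fast+
        fix e assume e: "e \<in> idempotents M"
          and r: "green_R M (e \<otimes>\<^bsub>M\<^esub> x) e \<or> green_R M (e \<otimes>\<^bsub>M\<^esub> z) e"
        then show "e \<otimes>\<^bsub>M\<^esub> x = e \<otimes>\<^bsub>M\<^esub> z"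
          using sim_KD[OF xy e] sim_KD[OF yz e] by metis
      qed
    qed
  qed
  moreover have "(x \<otimes>\<^bsub>M\<^esub> z, y \<otimes>\<^bsub>M\<^esub> z) \<in> sim_K M \<and> (z \<otimes>\<^bsub>M\<^esub> x, z \<otimes>\<^bsub>M\<^esub> y) \<in> sim_K M"
    if xy: "(x, y) \<in> sim_K M" and z: "z \<in> carrier M" for x y z
  proof -
    have right: "e \<otimes>\<^bsub>M\<^esub> (x \<otimes>\<^bsub>M\<^esub> z) = e \<otimes>\<^bsub>M\<^esub> (y \<otimes>\<^bsub>M\<^esub> z)"
      if xy: "(x, y) \<in> sim_K M" and e: "e \<in> idempotents M"
        and r: "green_R M (e \<otimes>\<^bsub>M\<^esub> (x \<otimes>\<^bsub>M\<^esub> z)) e" for x y e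
    proof -
      have c: "x \<in> carrier M" "y \<in> carrier M" "e \<in> carrier M"
        using sim_K_carrier[OF xy] e unfolding idempotents_def by blast+
      obtain w where w: "w \<in> carrier M" "e \<otimes>\<^bsub>M\<^esub> (x \<otimes>\<^bsub>M\<^esub> z) \<otimes>\<^bsub>M\<^esub> w = e"
        using r c z green_R_idem_iff[OF assms] by auto
      have "e \<otimes>\<^bsub>M\<^esub> x \<otimes>\<^bsub>M\<^esub> (z \<otimes>\<^bsub>M\<^esub> w) = e"
        using w c z by (simp add: m_assoc)
      then have "green_R M (e \<otimes>\<^bsub>M\<^esub> x) e"
        using c z w green_R_idem_iff[OF assms] by blast
      then have "e \<otimes>\<^bsub>M\<^esub> x = e \<otimes>\<^bsub>M\<^esub> y"
        using sim_KD[OF xy e] by blast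
      then show ?thesis
        using c z by (simp flip: m_assoc)
    qed
    have left: "e \<otimes>\<^bsub>M\<^esub> (z \<otimes>\<^bsub>M\<^esub> x) = e \<otimes>\<^bsub>M\<^esub> (z \<otimes>\<^bsub>M\<^esub> y)"
      if xy: "(x, y) \<in> sim_K M" and e: "e \<in> idempotents M"
        and r: "green_R M (e \<otimes>\<^bsub>M\<^esub> (z \<otimes>\<^bsub>M\<^esub> x)) e" for x y e
    proof -
      have c: "x \<in> carrier M" "y \<in> carrier M" "e \<in> carrier M" "e \<otimes>\<^bsub>M\<^esub> e = e"
        using sim_K_carrier[OF xy] e unfolding idempotents_def by blast+
      obtain w where w: "w \<in> carrier M" "e \<otimes>\<^bsub>M\<^esub> (z \<otimes>\<^bsub>M\<^esub> x) \<otimes>\<^bsub>M\<^esub> w = e"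
        using r c z green_R_idem_iff[OF assms] by auto
      define u where "u = x \<otimes>\<^bsub>M\<^esub> w"
      define g where "g = u \<otimes>\<^bsub>M\<^esub> (e \<otimes>\<^bsub>M\<^esub> z)"
      have u: "u \<in> carrier M" using c w by (simp add: u_def)
      have ezu: "(e \<otimes>\<^bsub>M\<^esub> z) \<otimes>\<^bsub>M\<^esub> u = e" using w c z by (simp add: u_def m_assoc)
      have g: "g \<in> carrier M" using u c z by (simp add: g_def)
      have ezg: "(e \<otimes>\<^bsub>M\<^esub> z) \<otimes>\<^bsub>M\<^esub> g = e \<otimes>\<^bsub>M\<^esub> z"
      proof -
        have "(e \<otimes>\<^bsub>M\<^esub> z) \<otimes>\<^bsub>M\<^esub> g = ((e \<otimes>\<^bsub>M\<^esub> z) \<otimes>\<^bsub>M\<^esub> u) \<otimes>\<^bsub>M\<^esub> (e \<otimes>\<^bsub>M\<^esub> z)"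
          unfolding g_def using u c z by (simp add: m_assoc)
        also have "\<dots> = (e \<otimes>\<^bsub>M\<^esub> e) \<otimes>\<^bsub>M\<^esub> z" unfolding ezu using c(1-3) z by (simp add: m_assoc)
        finally show ?thesis using c by simp
      qed
      have "g \<otimes>\<^bsub>M\<^esub> g = u \<otimes>\<^bsub>M\<^esub> ((e \<otimes>\<^bsub>M\<^esub> z) \<otimes>\<^bsub>M\<^esub> g)"
        using m_assoc[OF u _ g, of "e \<otimes>\<^bsub>M\<^esub> z"] c(3) z unfolding g_def[symmetric] by blast
      then have "g \<otimes>\<^bsub>M\<^esub> g = g" unfolding ezg g_def[symmetric] .
      then have gi: "g \<in> idempotents M" using g by (simp add: idempotents_def)
      have "g \<otimes>\<^bsub>M\<^esub> x \<otimes>\<^bsub>M\<^esub> (w \<otimes>\<^bsub>M\<^esub> (e \<otimes>\<^bsub>M\<^esub> z)) = g \<otimes>\<^bsub>M\<^esub> g"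
        using g c z w by (simp add: g_def u_def m_assoc)
      then have "green_R M (g \<otimes>\<^bsub>M\<^esub> x) g"
        using \<open>g \<otimes>\<^bsub>M\<^esub> g = g\<close> c z w g green_R_idem_iff[OF assms, of g x] by auto
      then have gxy: "g \<otimes>\<^bsub>M\<^esub> x = g \<otimes>\<^bsub>M\<^esub> y"
        using sim_KD[OF xy gi] by blast
      have "(e \<otimes>\<^bsub>M\<^esub> z) \<otimes>\<^bsub>M\<^esub> x = (e \<otimes>\<^bsub>M\<^esub> z) \<otimes>\<^bsub>M\<^esub> (g \<otimes>\<^bsub>M\<^esub> x)"
        using ezg c z g by (simp flip: m_assoc)
      also have "\<dots> = (e \<otimes>\<^bsub>M\<^esub> z) \<otimes>\<^bsub>M\<^esub> g \<otimes>\<^bsub>M\<^esub> y"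
        unfolding gxy using c z g by (simp add: m_assoc)
      also have "\<dots> = (e \<otimes>\<^bsub>M\<^esub> z) \<otimes>\<^bsub>M\<^esub> y" unfolding ezg ..
      finally show ?thesis using c z by (simp add: m_assoc)
    qed
    have yx: "(y, x) \<in> sim_K M" using xy \<open>equiv (carrier M) (sim_K M)\<close> by (meson equiv_def symD)
    have c: "x \<in> carrier M" "y \<in> carrier M" using sim_K_carrier[OF xy] by blast+
    have "e \<otimes>\<^bsub>M\<^esub> (x \<otimes>\<^bsub>M\<^esub> z) = e \<otimes>\<^bsub>M\<^esub> (y \<otimes>\<^bsub>M\<^esub> z)"
      if "e \<in> idempotents M"
        "green_R M (e \<otimes>\<^bsub>M\<^esub> (x \<otimes>\<^bsub>M\<^esub> z)) e \<or> green_R M (e \<otimes>\<^bsub>M\<^esub> (y \<otimes>\<^bsub>M\<^esub> z)) e" for e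
      using that right[OF xy] right[OF yx] by metis
    moreover have "e \<otimes>\<^bsub>M\<^esub> (z \<otimes>\<^bsub>M\<^esub> x) = e \<otimes>\<^bsub>M\<^esub> (z \<otimes>\<^bsub>M\<^esub> y)"
      if "e \<in> idempotents M"
        "green_R M (e \<otimes>\<^bsub>M\<^esub> (z \<otimes>\<^bsub>M\<^esub> x)) e \<or> green_R M (e \<otimes>\<^bsub>M\<^esub> (z \<otimes>\<^bsub>M\<^esub> y)) e" for e
      using that left[OF xy] left[OF yx] by metis
    ultimately show ?thesis
      using c z by (intro conjI sim_KI) (simp_all only: m_closed)
  qed
  ultimately show ?thesis unfolding monoid_congruence_def by auto
qed

definition opposite_monoid :: "'a monoid \<Rightarrow> 'a monoid" where
  "opposite_monoid M = M\<lparr>mult := (\<lambda>x y. y \<otimes>\<^bsub>M\<^esub> x)\<rparr>"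

lemma sim_D_eq_sim_K_opposite: "sim_D M = sim_K (opposite_monoid M)"
  by (simp add: sim_D_def sim_K_def opposite_monoid_def green_R_def green_L_def
      l_coset_def r_coset_def idempotents_def)

lemma sim_D_congruence:
  assumes "monoid M"
  shows "monoid_congruence M (sim_D M)"
proof -
  interpret monoid M by fact
  have "monoid (opposite_monoid M)"
    by (rule monoidI) (auto simp: opposite_monoid_def m_assoc)
  from sim_K_congruence[OF this] show ?thesis
    unfolding sim_D_eq_sim_K_opposite
    by (auto simp: monoid_congruence_def opposite_monoid_def)
qed


section \<open>The Trotter--Weil hierarchy\<close>

definition K_malcev :: "nat monoid set \<Rightarrow> nat monoid set" where
  "K_malcev V = {M \<in> fin_monoids. belongs_to (quotient_monoid M (sim_K M)) V}"

definition D_malcev :: "nat monoid set \<Rightarrow> nat monoid set" where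
  "D_malcev V = {M \<in> fin_monoids. belongs_to (quotient_monoid M (sim_D M)) V}"

definition R_trivial_monoids :: "nat monoid set" where
  "R_trivial_monoids =
     {M \<in> fin_monoids. \<forall>x\<in>carrier M. \<forall>y\<in>carrier M. green_R M x y \<longrightarrow> x = y}"

definition L_trivial_monoids :: "nat monoid set" where
  "L_trivial_monoids =
     {M \<in> fin_monoids. \<forall>x\<in>carrier M. \<forall>y\<in>carrier M. green_L M x y \<longrightarrow> x = y}"

text \<open>The hierarchy starts at index 2; indices 0 and 1 are deliberately left unspecified.\<close>

fun TW_R :: "nat \<Rightarrow> nat monoid set" and TW_L :: "nat \<Rightarrow> nat monoid set" where
  "TW_R (Suc (Suc 0)) = R_trivial_monoids"
| "TW_R (Suc (Suc (Suc k))) = K_malcev (TW_L (Suc (Suc k)))"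
| "TW_L (Suc (Suc 0)) = L_trivial_monoids"
| "TW_L (Suc (Suc (Suc k))) = D_malcev (TW_R (Suc (Suc k)))"

end

theory Submission
  imports Defs
begin

text \<open>Since \<open>TW_L m\<close> consists of the opposites of the monoids in \<open>TW_R m\<close>, only one side has to be
  treated: \<open>TW_R (m + 1) = K_malcev (opposite_class (TW_R m))\<close>. The join is separated from the
  intersection by the identities \<open>U\<^sub>m = V\<^sub>m\<close> with \<open>U\<^sub>1 = a\<close>, \<open>V\<^sub>1 = 1\<close>,
  \<open>U\<^sub>j\<^sub>+\<^sub>1 = (U\<^sub>j x\<^sub>j)\<^sup>\<omega> U\<^sub>j (y\<^sub>j U\<^sub>j)\<^sup>\<omega>\<close> and \<open>V\<^sub>j\<^sub>+\<^sub>1 = (U\<^sub>j x\<^sub>j)\<^sup>\<omega> V\<^sub>j (y\<^sub>j U\<^sub>j)\<^sup>\<omega>\<close>. They pass from one level to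
  the next because \<open>e = (U\<^sub>j x\<^sub>j)\<^sup>\<omega>\<close> is \<open>\<R>\<close>-equivalent to \<open>e U\<^sub>j\<close>, so that \<open>U\<^sub>j \<sim>\<^sub>K V\<^sub>j\<close> gives
  \<open>e U\<^sub>j = e V\<^sub>j\<close>. Conversely, if \<open>M\<close> lies in the intersection at one level and violates the
  \<open>j\<close>-th identity, then the monoid that remembers of a word over \<open>M\<close> and two new letters \<open>x\<close>, \<open>y\<close>
  what lies between the last \<open>x\<close> and the first \<open>y\<close> lies in the intersection one level up and
  violates the next identity. (The functions \<open>omega_lhs\<close>, \<open>omega_rhs\<close> below count from 0, so index
  \<open>j\<close> there is \<open>U\<^sub>j\<^sub>+\<^sub>1 = V\<^sub>j\<^sub>+\<^sub>1\<close>.)\<close>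

section \<open>Divisors and varieties\<close>

text \<open>Polymorphic counterpart of \<open>fin_monoids\<close>: quotients, products and marked
  monoids arise over types other than \<open>nat\<close>.\<close>

abbreviation fin_monoid :: "'a monoid \<Rightarrow> bool" where
  "fin_monoid M \<equiv> monoid M \<and> finite (carrier M)"

text \<open>\<open>hom\<close> does not ask for the unit to be preserved, and for maps that are not
  surjective this is not automatic.\<close>

definition monoid_homs :: "'a monoid \<Rightarrow> 'b monoid \<Rightarrow> ('a \<Rightarrow> 'b) set" where
  "monoid_homs M N = {f \<in> hom M N. f \<one>\<^bsub>M\<^esub> = \<one>\<^bsub>N\<^esub>}"

lemma monoid_homsI:
  assumes "\<And>x. x \<in> carrier M \<Longrightarrow> f x \<in> carrier N"
    and "\<And>x y. x \<in> carrier M \<Longrightarrow> y \<in> carrier M \<Longrightarrow> f (x \<otimes>\<^bsub>M\<^esub> y) = f x \<otimes>\<^bsub>N\<^esub> f y"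
    and "f \<one>\<^bsub>M\<^esub> = \<one>\<^bsub>N\<^esub>"
  shows "f \<in> monoid_homs M N"
  using assms by (auto simp: monoid_homs_def hom_def)

lemma monoid_homsD:
  assumes "f \<in> monoid_homs M N"
  shows "x \<in> carrier M \<Longrightarrow> f x \<in> carrier N"
    and "x \<in> carrier M \<Longrightarrow> y \<in> carrier M \<Longrightarrow> f (x \<otimes>\<^bsub>M\<^esub> y) = f x \<otimes>\<^bsub>N\<^esub> f y"
    and "f \<one>\<^bsub>M\<^esub> = \<one>\<^bsub>N\<^esub>"
  using assms by (auto simp: monoid_homs_def hom_def)

lemma epiI:
  assumes "f \<in> monoid_homs M N" "\<And>y. y \<in> carrier N \<Longrightarrow> \<exists>x\<in>carrier M. f x = y"
  shows "f \<in> epi M N"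
  using assms by (fastforce simp: epi_def monoid_homs_def hom_def)

text \<open>A preimage \<open>e\<close> of the unit gives
  \<open>f 1 = f 1 * f e = f (1 * e) = f e = 1\<close>.\<close>

lemma epi_monoid_homs:
  assumes "monoid M" "monoid N" "f \<in> epi M N"
  shows "f \<in> monoid_homs M N"
proof -
  interpret M: monoid M by fact
  interpret N: monoid N by fact
  have hom: "f \<in> hom M N" and onto: "f ` carrier M = carrier N"
    using assms(3) by (auto simp: epi_def)
  obtain e where e: "e \<in> carrier M" "f e = \<one>\<^bsub>N\<^esub>"
    using onto by (metis N.one_closed imageE)
  have "f \<one>\<^bsub>M\<^esub> = f \<one>\<^bsub>M\<^esub> \<otimes>\<^bsub>N\<^esub> f e"
    using e hom by (simp add: hom_in_carrier)
  also have "\<dots> = \<one>\<^bsub>N\<^esub>"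
    using e hom by (metis M.l_one M.one_closed hom_mult)
  finally show ?thesis using hom by (simp add: monoid_homs_def)
qed

lemma epi_surj:
  assumes "f \<in> epi M N" "y \<in> carrier N"
  obtains x where "x \<in> carrier M" "f x = y"
proof -
  have "y \<in> f ` carrier M" using assms by (simp add: epi_def)
  then show ?thesis using that by blast
qed

lemma id_epi: "(\<lambda>x. x) \<in> epi M M"
  by (simp add: epi_def hom_def)

lemma iso_epi: "f \<in> iso M N \<Longrightarrow> f \<in> epi M N"
  by (simp add: iso_iff_mon_epi)

lemma iso_inverse:
  assumes "monoid M" "f \<in> iso M N"
  obtains g where "g \<in> iso N M" "\<And>x. x \<in> carrier M \<Longrightarrow> g (f x) = x"
    "\<And>y. y \<in> carrier N \<Longrightarrow> f (g y) = y"
proof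
  interpret monoid M by fact
  let ?g = "inv_into (carrier M) f"
  have f: "f \<in> hom M N" "bij_betw f (carrier M) (carrier N)"
    using assms(2) by (auto simp: iso_def)
  show gf: "?g (f x) = x" if "x \<in> carrier M" for x
    using that f(2) by (simp add: bij_betw_inv_into_left)
  show fg: "f (?g y) = y" if "y \<in> carrier N" for y
    using that f(2) by (simp add: bij_betw_inv_into_right)
  have g: "bij_betw ?g (carrier N) (carrier M)"
    using f(2) by (rule bij_betw_inv_into)
  then have gc: "?g y \<in> carrier M" if "y \<in> carrier N" for y
    using that by (auto simp: bij_betw_def)
  have "?g (x \<otimes>\<^bsub>N\<^esub> y) = ?g x \<otimes>\<^bsub>M\<^esub> ?g y" if "x \<in> carrier N" "y \<in> carrier N" for x y
  proof -
    have "x \<otimes>\<^bsub>N\<^esub> y = f (?g x \<otimes>\<^bsub>M\<^esub> ?g y)"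
      using that by (simp add: hom_mult[OF f(1)] gc fg)
    then show ?thesis using that by (simp add: gf gc)
  qed
  with g gc show "?g \<in> iso N M" by (simp add: iso_def hom_def)
qed

lemma nat_copy:
  fixes M :: "'a monoid"
  assumes "fin_monoid M"
  obtains N f where "N \<in> fin_monoids" "f \<in> iso M N"
  using assms finite_monoid_nat_copy[of M] by (auto simp: belongs_to_def is_iso_def)

lemma variety_fin_monoid: "variety V \<Longrightarrow> M \<in> V \<Longrightarrow> fin_monoid M"
  by (auto simp: variety_def fin_monoids_def)

lemma fin_monoids_iff: "M \<in> fin_monoids \<longleftrightarrow> fin_monoid M"
  by (simp add: fin_monoids_def)

lemma variety_epi:
  "variety V \<Longrightarrow> M \<in> V \<Longrightarrow> fin_monoid N \<Longrightarrow> f \<in> epi M N \<Longrightarrow> N \<in> V"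
  unfolding variety_def fin_monoids_def by blast

lemma belongs_to_refl: "M \<in> V \<Longrightarrow> belongs_to M V"
  unfolding belongs_to_def using iso_refl by blast

text \<open>Isomorphisms are surjective homomorphisms, so closure under images turns
  \<open>belongs_to\<close> into plain membership for monoids over \<open>nat\<close>.\<close>

lemma belongs_to_nat:
  assumes "variety V" "belongs_to M V" "fin_monoid M"
  shows "M \<in> V"
proof -
  obtain N f where "N \<in> V" "f \<in> iso N M"
    using assms(2,3) iso_inverse unfolding belongs_to_def is_iso_def by (metis all_not_in_conv)
  then show ?thesis
    using variety_epi[OF assms(1) _ assms(3)] iso_epi by blast
qed

lemma variety_divisor:
  fixes S :: "'s monoid" and M :: "'a monoid" and Q :: "'q monoid"
  assumes V: "variety V" and Q: "belongs_to Q V" "monoid Q" and S: "monoid S"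
    and \<psi>: "\<psi> \<in> monoid_homs S Q" and \<phi>: "\<phi> \<in> epi S M" and M: "fin_monoid M"
    and ker: "\<And>a b. a \<in> carrier S \<Longrightarrow> b \<in> carrier S \<Longrightarrow> \<psi> a = \<psi> b \<Longrightarrow> \<phi> a = \<phi> b"
  shows "belongs_to M V"
proof -
  interpret S: monoid S by fact
  obtain Q' f where Q': "Q' \<in> V" and f: "f \<in> iso Q Q'"
    using Q(1) by (auto simp: belongs_to_def is_iso_def)
  have mQ': "monoid Q'" using variety_fin_monoid[OF V Q'] by simp
  interpret Q': monoid Q' by fact
  obtain M' g where M': "M' \<in> fin_monoids" and g: "g \<in> iso M M'"
    using nat_copy[OF M] .
  have fh: "f \<in> monoid_homs Q Q'"
    using epi_monoid_homs[OF Q(2) mQ' iso_epi[OF f]] .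
  define \<theta> where "\<theta> = f \<circ> \<psi>"
  have \<theta>: "\<theta> \<in> monoid_homs S Q'"
    using monoid_homsD[OF \<psi>] monoid_homsD[OF fh] by (intro monoid_homsI) (auto simp: \<theta>_def)
  define H where "H = \<theta> ` carrier S"
  have H: "submonoid H Q'"
  proof
    show "H \<subseteq> carrier Q'" using monoid_homsD[OF \<theta>] by (auto simp: H_def)
    show "\<one>\<^bsub>Q'\<^esub> \<in> H" using monoid_homsD(3)[OF \<theta>] unfolding H_def by (metis S.one_closed imageI)
    show "x \<otimes>\<^bsub>Q'\<^esub> y \<in> H" if xy: "x \<in> H" "y \<in> H" for x y
    proof -
      obtain a where "x = \<theta> a" "a \<in> carrier S" using xy(1) unfolding H_def by (rule imageE)
      moreover obtain b where "y = \<theta> b" "b \<in> carrier S"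
        using xy(2) unfolding H_def by (rule imageE)
      ultimately show ?thesis
        using monoid_homsD(2)[OF \<theta>, of a b, symmetric] by (simp add: H_def)
    qed
  qed
  have ker': "g (\<phi> a) = g (\<phi> b)" if "a \<in> carrier S" "b \<in> carrier S" "\<theta> a = \<theta> b" for a b
  proof -
    have "\<psi> a = \<psi> b"
      using that monoid_homsD(1)[OF \<psi>] f by (auto simp: \<theta>_def iso_def bij_betw_def inj_on_def)
    then have "\<phi> a = \<phi> b" by (rule ker[OF that(1,2)])
    then show ?thesis by simp
  qed
  \<comment> \<open>\<open>inv_into\<close> picks an arbitrary preimage; \<open>ker'\<close> makes
    the value independent of this choice.\<close>
  define h where "h q = g (\<phi> (inv_into (carrier S) \<theta> q))" for q
  have h: "h (\<theta> a) = g (\<phi> a)" if "a \<in> carrier S" for a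
  proof -
    have "\<theta> a \<in> \<theta> ` carrier S" using that by (rule imageI)
    then show ?thesis
      unfolding h_def using that by (intro ker' inv_into_into f_inv_into_f)
  qed
  have \<phi>h: "\<phi> \<in> hom S M" and gh: "g \<in> hom M M'"
    using \<phi> g by (simp_all add: epi_def iso_def)
  note hom = hom_in_carrier[OF \<phi>h] hom_in_carrier[OF gh] hom_mult[OF \<phi>h] hom_mult[OF gh]
  have "h \<in> epi (Q'\<lparr>carrier := H\<rparr>) M'"
  proof -
    have "h \<in> hom (Q'\<lparr>carrier := H\<rparr>) M'"
    proof (rule homI)
      fix x assume "x \<in> carrier (Q'\<lparr>carrier := H\<rparr>)"
      then show "h x \<in> carrier M'" by (auto simp: H_def h hom)
    next
      fix x y assume "x \<in> carrier (Q'\<lparr>carrier := H\<rparr>)" "y \<in> carrier (Q'\<lparr>carrier := H\<rparr>)"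
      then have "x \<in> \<theta> ` carrier S" "y \<in> \<theta> ` carrier S" by (simp_all add: H_def)
      then obtain a b where ab: "a \<in> carrier S" "b \<in> carrier S" "x = \<theta> a" "y = \<theta> b"
        by (elim imageE)
      have "h (x \<otimes>\<^bsub>Q'\<^esub> y) = h (\<theta> (a \<otimes>\<^bsub>S\<^esub> b))"
        using ab monoid_homsD(2)[OF \<theta>] by simp
      also have "\<dots> = h x \<otimes>\<^bsub>M'\<^esub> h y"
        using ab by (simp add: h hom)
      finally show "h (x \<otimes>\<^bsub>Q'\<lparr>carrier := H\<rparr>\<^esub> y) = h x \<otimes>\<^bsub>M'\<^esub> h y" by simp
    qed
    moreover have "carrier M' \<subseteq> h ` H"
    proof
      fix y assume "y \<in> carrier M'"
      then obtain x where x: "x \<in> carrier M" "g x = y" using epi_surj[OF iso_epi[OF g]] by metis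
      then obtain a where "a \<in> carrier S" "\<phi> a = x" using epi_surj[OF \<phi>] by metis
      then show "y \<in> h ` H" using x h by (force simp: H_def)
    qed
    ultimately show ?thesis by (simp add: epi_iff_subset)
  qed
  moreover have "Q'\<lparr>carrier := H\<rparr> \<in> V"
    using V Q' H by (auto simp: variety_def)
  ultimately have "M' \<in> V"
    using variety_epi[OF V] M' by (auto simp: fin_monoids_def)
  then show ?thesis using g unfolding belongs_to_def is_iso_def by blast
qed

section \<open>Products and intersections of varieties\<close>

lemma monoid_product_group:
  assumes M: "\<And>i. i \<in> I \<Longrightarrow> monoid (M i)"
  shows "monoid (product_group I M)"
proof (rule monoidI)
  show "\<one>\<^bsub>product_group I M\<^esub> \<in> carrier (product_group I M)"
    using M by (simp add: PiE_iff monoid.one_closed)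
next
  fix x y z assume x: "x \<in> carrier (product_group I M)" and y: "y \<in> carrier (product_group I M)"
    and z: "z \<in> carrier (product_group I M)"
  show "x \<otimes>\<^bsub>product_group I M\<^esub> y \<in> carrier (product_group I M)"
    using M x y by (simp add: PiE_iff monoid.m_closed)
  show "x \<otimes>\<^bsub>product_group I M\<^esub> y \<otimes>\<^bsub>product_group I M\<^esub> z
      = x \<otimes>\<^bsub>product_group I M\<^esub> (y \<otimes>\<^bsub>product_group I M\<^esub> z)"
    using M x y z by (auto simp: PiE_iff monoid.m_assoc intro: restrict_ext)
next
  fix x assume x: "x \<in> carrier (product_group I M)"
  show "\<one>\<^bsub>product_group I M\<^esub> \<otimes>\<^bsub>product_group I M\<^esub> x = x"
    "x \<otimes>\<^bsub>product_group I M\<^esub> \<one>\<^bsub>product_group I M\<^esub> = x"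
    using M x by (auto simp: PiE_iff monoid.l_one monoid.r_one extensional_def fun_eq_iff)
qed

lemma belongs_to_product:
  fixes M :: "nat \<Rightarrow> nat monoid"
  shows "variety V \<Longrightarrow> (\<And>i. i < n \<Longrightarrow> M i \<in> V) \<Longrightarrow> belongs_to (product_group {..<n} M) V"
  by (auto simp: variety_def)

text \<open>The pairing of \<open>\<alpha>\<close> and \<open>\<beta>\<close> maps \<open>S\<close>
  into a product of two members of \<open>V\<close>, and its kernel lies in that of
  \<open>\<phi>\<close>. The product is indexed by \<open>{..<2}\<close> to fit the definition of
  \<open>variety\<close>.\<close>

lemma variety_divisor_product:
  assumes V: "variety V" and A: "belongs_to A V" "monoid A" and B: "belongs_to B V" "monoid B"
    and S: "monoid S" and \<alpha>: "\<alpha> \<in> monoid_homs S A" and \<beta>: "\<beta> \<in> monoid_homs S B"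
    and \<phi>: "\<phi> \<in> epi S M" and M: "fin_monoid M"
    and ker: "\<And>a b. a \<in> carrier S \<Longrightarrow> b \<in> carrier S \<Longrightarrow> \<alpha> a = \<alpha> b \<Longrightarrow> \<beta> a = \<beta> b \<Longrightarrow> \<phi> a = \<phi> b"
  shows "belongs_to M V"
proof -
  obtain A' f where A': "A' \<in> V" and f: "f \<in> iso A A'"
    using A(1) by (auto simp: belongs_to_def is_iso_def)
  obtain B' g where B': "B' \<in> V" and g: "g \<in> iso B B'"
    using B(1) by (auto simp: belongs_to_def is_iso_def)
  define P where "P i = (if i = 0 then A' else B')" for i :: nat
  have P: "P i \<in> V" for i using A' B' by (simp add: P_def)
  have mP: "monoid (product_group {..<2} P)"
    using P variety_fin_monoid[OF V] by (intro monoid_product_group) blast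
  have fh: "f \<in> monoid_homs A A'"
    using epi_monoid_homs[OF A(2) _ iso_epi[OF f]] variety_fin_monoid[OF V A'] by blast
  have gh: "g \<in> monoid_homs B B'"
    using epi_monoid_homs[OF B(2) _ iso_epi[OF g]] variety_fin_monoid[OF V B'] by blast
  define \<theta> where "\<theta> s = (\<lambda>i\<in>{..<2::nat}. if i = 0 then f (\<alpha> s) else g (\<beta> s))" for s
  have "\<theta> \<in> monoid_homs S (product_group {..<2} P)"
    using monoid_homsD[OF fh] monoid_homsD[OF gh] monoid_homsD[OF \<alpha>] monoid_homsD[OF \<beta>]
    by (intro monoid_homsI) (auto simp: \<theta>_def P_def fun_eq_iff)
  moreover have "\<phi> a = \<phi> b" if ab: "a \<in> carrier S" "b \<in> carrier S" and eq: "\<theta> a = \<theta> b" for a b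
  proof (rule ker[OF ab])
    have "f (\<alpha> a) = f (\<alpha> b)" "g (\<beta> a) = g (\<beta> b)"
      using fun_cong[OF eq, of 0] fun_cong[OF eq, of 1] by (simp_all add: \<theta>_def)
    then show "\<alpha> a = \<alpha> b" "\<beta> a = \<beta> b"
      using ab f g monoid_homsD(1)[OF \<alpha>] monoid_homsD(1)[OF \<beta>]
      by (auto simp: iso_def bij_betw_def inj_on_def)
  qed
  ultimately show ?thesis
    using variety_divisor[OF V belongs_to_product[OF V P] mP S _ \<phi> M] by blast
qed

text \<open>Only products need an argument, since \<open>V\<close> and \<open>W\<close> may supply
  different copies over \<open>nat\<close>: the copy found in \<open>V\<close> is an image of the
  product and hence lies in \<open>W\<close> as well.\<close>

lemma variety_Int:
  assumes V: "variety V" and W: "variety W"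
  shows "variety (V \<inter> W)"
proof -
  have "belongs_to (product_group {..<n} M) (V \<inter> W)" if M: "\<forall>i<n. M i \<in> V \<inter> W"
    for n :: nat and M :: "nat \<Rightarrow> nat monoid"
  proof -
    let ?P = "product_group {..<n} M"
    have mP: "monoid ?P"
      using M variety_fin_monoid[OF V] by (intro monoid_product_group) auto
    obtain N f where N: "N \<in> V" "f \<in> iso ?P N"
      using belongs_to_product[OF V, of n M] M by (auto simp: belongs_to_def is_iso_def)
    have "belongs_to N W"
      using N epi_monoid_homs[OF _ mP id_epi] mP variety_fin_monoid[OF V] M
      by (intro variety_divisor[OF W belongs_to_product[OF W, of n M] mP mP _ iso_epi[OF N(2)]]) auto
    then have "N \<in> W" using belongs_to_nat[OF W] variety_fin_monoid[OF V] N by blast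
    then show ?thesis using N by (auto simp: belongs_to_def is_iso_def)
  qed
  then show ?thesis
    using V W unfolding variety_def by (meson Int_iff le_infI1)
qed

section \<open>Duality\<close>

lemma opposite_simps [simp]:
  "carrier (opposite_monoid M) = carrier M" "one (opposite_monoid M) = one M"
  "mult (opposite_monoid M) = (\<lambda>x y. y \<otimes>\<^bsub>M\<^esub> x)"
  "opposite_monoid (opposite_monoid M) = M"
  by (simp_all add: opposite_monoid_def)

lemma monoid_opposite [simp]: "monoid (opposite_monoid M) = monoid M"
proof -
  have "monoid (opposite_monoid N)" if "monoid N" for N :: "'a monoid"
    using that by (intro monoidI) (auto simp: monoid.m_assoc monoid.m_closed)
  from this[of M] this[of "opposite_monoid M"] show ?thesis by auto
qed

lemma opposite_fin_monoids [simp]: "opposite_monoid M \<in> fin_monoids \<longleftrightarrow> M \<in> fin_monoids"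
  by (simp add: fin_monoids_def)

lemma hom_opposite [simp]: "hom (opposite_monoid M) (opposite_monoid N) = hom M N"
  by (auto simp: hom_def)

lemma epi_opposite [simp]: "epi (opposite_monoid M) (opposite_monoid N) = epi M N"
  by (simp add: epi_def)

lemma iso_opposite [simp]: "opposite_monoid M \<cong> opposite_monoid N \<longleftrightarrow> M \<cong> N"
  by (simp add: is_iso_def iso_def)

lemma opposite_product_group:
  "opposite_monoid (product_group I M) = product_group I (\<lambda>i. opposite_monoid (M i))"
  by (simp add: opposite_monoid_def product_group_def)

definition opposite_class :: "nat monoid set \<Rightarrow> nat monoid set" where
  "opposite_class V = {M. opposite_monoid M \<in> V}"

lemma in_opposite_class [simp]: "M \<in> opposite_class V \<longleftrightarrow> opposite_monoid M \<in> V"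
  by (simp add: opposite_class_def)

lemma opposite_class_mono: "V \<subseteq> W \<Longrightarrow> opposite_class V \<subseteq> opposite_class W"
  by auto

lemma belongs_to_opposite_class:
  "belongs_to M (opposite_class V) \<longleftrightarrow> belongs_to (opposite_monoid M) V"
proof
  assume "belongs_to M (opposite_class V)"
  then obtain N where "opposite_monoid N \<in> V" "M \<cong> N" by (auto simp: belongs_to_def)
  then show "belongs_to (opposite_monoid M) V"
    unfolding belongs_to_def by (intro bexI[of _ "opposite_monoid N"]) simp_all
next
  assume "belongs_to (opposite_monoid M) V"
  then obtain N where N: "N \<in> V" "opposite_monoid M \<cong> N" by (auto simp: belongs_to_def)
  then have "M \<cong> opposite_monoid N"
    by (metis iso_opposite opposite_simps(4))
  with N show "belongs_to M (opposite_class V)"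
    unfolding belongs_to_def by (intro bexI[of _ "opposite_monoid N"]) simp_all
qed

text \<open>Reversing the multiplication commutes with submonoids, surjective homomorphisms and
  products, so each closure property is inherited from \<open>V\<close>.\<close>

lemma variety_opposite_class:
  assumes V: "variety V"
  shows "variety (opposite_class V)"
  unfolding variety_def
proof (intro conjI ballI allI impI)
  show "opposite_class V \<subseteq> fin_monoids"
    using V opposite_fin_monoids by (auto simp: variety_def)
  show "M\<lparr>carrier := H\<rparr> \<in> opposite_class V" if "M \<in> opposite_class V" "submonoid H M" for M H
  proof -
    have "submonoid H (opposite_monoid M)"
      using that(2) by (simp add: submonoid_def)
    then have "(opposite_monoid M)\<lparr>carrier := H\<rparr> \<in> V"
      using V that(1) by (auto simp: variety_def)
    moreover have "opposite_monoid (M\<lparr>carrier := H\<rparr>) = (opposite_monoid M)\<lparr>carrier := H\<rparr>"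
      by (rule monoid.equality) (simp_all add: opposite_monoid_def)
    ultimately show ?thesis by (simp only: in_opposite_class)
  qed
  show "N \<in> opposite_class V"
    if "M \<in> opposite_class V" "N \<in> fin_monoids" "epi M N \<noteq> {}" for M N
    using that V unfolding variety_def by (metis in_opposite_class opposite_fin_monoids epi_opposite)
  show "belongs_to (product_group {..<n} M) (opposite_class V)"
    if "\<forall>i<n. M i \<in> opposite_class V" for n :: nat and M
    using that belongs_to_product[OF V, of n "\<lambda>i. opposite_monoid (M i)"]
    by (simp add: belongs_to_opposite_class opposite_product_group)
qed

section \<open>Powers and Green's relations in finite monoids\<close>

text \<open>The powers of \<open>x\<close> cannot all differ, so from some index \<open>i\<close> on
  they have a period \<open>p\<close>; a positive multiple of \<open>p\<close> that is at least
  \<open>i\<close> is then an idempotent exponent.\<close>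

lemma (in monoid) idempotent_power:
  assumes "finite (carrier G)" "x \<in> carrier G"
  shows "\<exists>n>0. x [^] n \<otimes> x [^] n = x [^] (n::nat)"
proof -
  have "\<not> inj (\<lambda>n::nat. x [^] n)"
  proof
    assume "inj (\<lambda>n::nat. x [^] n)"
    then have "infinite (range (\<lambda>n::nat. x [^] n))"
      by (rule range_inj_infinite)
    moreover have "range (\<lambda>n::nat. x [^] n) \<subseteq> carrier G"
      using assms(2) by auto
    ultimately show False using assms(1) finite_subset by blast
  qed
  then obtain i j :: nat where "x [^] i = x [^] j" "i \<noteq> j"
    unfolding inj_on_def by blast
  then obtain i p :: nat where p: "p > 0" and ip: "x [^] (i + p) = x [^] i"
    by (metis less_imp_add_positive linorder_neqE_nat)
  have step: "x [^] (k + p) = x [^] k" if "k \<ge> i" for k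
  proof -
    have "x [^] (k + p) = x [^] (i + p) \<otimes> x [^] (k - i)"
      using that assms(2) by (simp add: nat_pow_mult add.commute)
    then show ?thesis using that assms(2) ip by (simp add: nat_pow_mult add.commute)
  qed
  have steps: "x [^] (k + p * c) = x [^] k" if "k \<ge> i" for k c
  proof (induction c)
    case (Suc c)
    have "x [^] (k + p * Suc c) = x [^] ((k + p * c) + p)" by (simp add: algebra_simps)
    also have "\<dots> = x [^] (k + p * c)" using step[of "k + p * c"] that by simp
    finally show ?case using Suc by simp
  qed simp
  \<comment> \<open>The factor \<open>i + 1\<close> in place of \<open>i\<close> keeps the exponent
    positive when \<open>i = 0\<close>.\<close>
  have "i \<le> p * (i + 1)" using p by (cases p) auto
  then have "x [^] (p * (i + 1)) \<otimes> x [^] (p * (i + 1)) = x [^] (p * (i + 1))"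
    using steps[of "p * (i + 1)" "i + 1"] assms(2) by (simp add: nat_pow_mult)
  then show ?thesis using p by (intro exI[of _ "p * (i + 1)"]) simp
qed

lemma (in monoid) idempotent_nat_pow:
  assumes "e \<in> carrier G" "e \<otimes> e = e" "k > 0"
  shows "e [^] (k::nat) = e"
  using assms(3)
proof (induction k)
  case (Suc k)
  then show ?case using assms(1,2) by (cases "k = 0") simp_all
qed simp

text \<open>A positive power of an idempotent is that idempotent, so every positive multiple of an
  idempotent exponent works again; the product of the exponents of all elements is therefore
  uniform.\<close>

lemma (in monoid) common_exponent:
  assumes fin: "finite (carrier G)"
  shows "\<exists>n>0. \<forall>x\<in>carrier G. \<forall>k>0. x [^] (n * k) \<otimes> x [^] (n * k) = x [^] (n * k :: nat)"
proof -
  obtain q :: "'a \<Rightarrow> nat" where q: "\<And>x. x \<in> carrier G \<Longrightarrow> q x > 0 \<and> x [^] q x \<otimes> x [^] q x = x [^] q x"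
    using idempotent_power[OF fin] by metis
  define n where "n = (\<Prod>x\<in>carrier G. q x)"
  have n: "n > 0" unfolding n_def using q by (simp add: prod_pos)
  have "x [^] (n * k) \<otimes> x [^] (n * k) = x [^] (n * k)" if x: "x \<in> carrier G" and k: "k > 0" for x and k :: nat
  proof -
    have "q x dvd n * k" unfolding n_def using x fin by (simp add: dvd_prodI)
    then obtain c where c: "n * k = q x * c" by blast
    then have "c > 0" using k n by (cases "c = 0") auto
    then have "x [^] (n * k) = x [^] q x"
      using x q idempotent_nat_pow[of "x [^] q x" c] by (simp add: c flip: nat_pow_pow)
    then show ?thesis using q x by simp
  qed
  with n show ?thesis by blast
qed

lemma nat_pow_monoid_homs:
  assumes "monoid M" "f \<in> monoid_homs M N" "x \<in> carrier M"
  shows "f (x [^]\<^bsub>M\<^esub> (n::nat)) = f x [^]\<^bsub>N\<^esub> n"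
  using assms by (induction n) (simp_all add: monoid_homsD monoid.nat_pow_closed)

section \<open>\<R>-equivalence and \<R>-trivial monoids\<close>

lemma green_R_iff:
  assumes "monoid M" "x \<in> carrier M" "y \<in> carrier M"
  shows "green_R M x y \<longleftrightarrow> (\<exists>s\<in>carrier M. \<exists>t\<in>carrier M. x \<otimes>\<^bsub>M\<^esub> s = y \<and> y \<otimes>\<^bsub>M\<^esub> t = x)"
proof -
  interpret monoid M by fact
  show ?thesis
  proof
    assume "green_R M x y"
    then have eq: "x <#\<^bsub>M\<^esub> carrier M = y <#\<^bsub>M\<^esub> carrier M" by (simp add: green_R_def)
    have "x \<in> x <#\<^bsub>M\<^esub> carrier M" "y \<in> y <#\<^bsub>M\<^esub> carrier M"
      using assms unfolding l_coset_def by (force intro: bexI[of _ "\<one>\<^bsub>M\<^esub>"])+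
    then have "x \<in> y <#\<^bsub>M\<^esub> carrier M" "y \<in> x <#\<^bsub>M\<^esub> carrier M" using eq by auto
    then obtain s t where "s \<in> carrier M" "t \<in> carrier M" "x \<otimes>\<^bsub>M\<^esub> s = y" "y \<otimes>\<^bsub>M\<^esub> t = x"
      unfolding l_coset_def by auto
    then show "\<exists>s\<in>carrier M. \<exists>t\<in>carrier M. x \<otimes>\<^bsub>M\<^esub> s = y \<and> y \<otimes>\<^bsub>M\<^esub> t = x" by blast
  next
    have incl: "b <#\<^bsub>M\<^esub> carrier M \<subseteq> a <#\<^bsub>M\<^esub> carrier M"
      if "a \<in> carrier M" "s \<in> carrier M" "a \<otimes>\<^bsub>M\<^esub> s = b" for a b s
      using that m_assoc[OF that(1,2)] unfolding l_coset_def by auto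
    assume "\<exists>s\<in>carrier M. \<exists>t\<in>carrier M. x \<otimes>\<^bsub>M\<^esub> s = y \<and> y \<otimes>\<^bsub>M\<^esub> t = x"
    then show "green_R M x y"
      unfolding green_R_def using incl assms by blast
  qed
qed

text \<open>Coset-free form of \<R>-triviality over any type: \<open>x s t = x\<close> says that
  \<open>x s\<close> is \<R>-equivalent to \<open>x\<close>.\<close>

definition R_trivial :: "'a monoid \<Rightarrow> bool" where
  "R_trivial M \<longleftrightarrow> (\<forall>x\<in>carrier M. \<forall>s\<in>carrier M. \<forall>t\<in>carrier M.
     x \<otimes>\<^bsub>M\<^esub> s \<otimes>\<^bsub>M\<^esub> t = x \<longrightarrow> x \<otimes>\<^bsub>M\<^esub> s = x)"

lemma R_trivialD:
  "R_trivial M \<Longrightarrow> x \<in> carrier M \<Longrightarrow> s \<in> carrier M \<Longrightarrow> t \<in> carrier M \<Longrightarrow>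
    x \<otimes>\<^bsub>M\<^esub> s \<otimes>\<^bsub>M\<^esub> t = x \<Longrightarrow> x \<otimes>\<^bsub>M\<^esub> s = x"
  by (auto simp: R_trivial_def)

lemma R_trivial_green_R:
  assumes "monoid M"
  shows "R_trivial M \<longleftrightarrow> (\<forall>x\<in>carrier M. \<forall>y\<in>carrier M. green_R M x y \<longrightarrow> x = y)"
proof -
  interpret monoid M by fact
  show ?thesis
    unfolding R_trivial_def using assms by (auto simp: green_R_iff) (metis m_closed)
qed

lemma R_trivial_monoids_iff: "M \<in> R_trivial_monoids \<longleftrightarrow> fin_monoid M \<and> R_trivial M"
  by (auto simp: R_trivial_monoids_def fin_monoids_def R_trivial_green_R)

lemma L_trivial_monoids_opposite: "L_trivial_monoids = opposite_class R_trivial_monoids"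
  by (auto simp: R_trivial_monoids_def L_trivial_monoids_def fin_monoids_def
      green_R_def green_L_def l_coset_def r_coset_def)

lemma R_trivial_sub:
  assumes "R_trivial N" "f \<in> monoid_homs M N" "inj_on f (carrier M)" "monoid M"
  shows "R_trivial M"
  unfolding R_trivial_def
proof (intro ballI impI)
  interpret monoid M by fact
  fix x s t assume *: "x \<in> carrier M" "s \<in> carrier M" "t \<in> carrier M" "x \<otimes>\<^bsub>M\<^esub> s \<otimes>\<^bsub>M\<^esub> t = x"
  then have "f x \<otimes>\<^bsub>N\<^esub> f s \<otimes>\<^bsub>N\<^esub> f t = f x"
    using monoid_homsD(2)[OF assms(2), symmetric] by simp
  then have "f (x \<otimes>\<^bsub>M\<^esub> s) = f x"
    using * R_trivialD[OF assms(1), of "f x" "f s" "f t"] monoid_homsD[OF assms(2)] by simp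
  then show "x \<otimes>\<^bsub>M\<^esub> s = x"
    using * assms(3) by (meson inj_onD m_closed)
qed

lemma belongs_to_R_trivial:
  assumes "fin_monoid M" "R_trivial M"
  shows "belongs_to M R_trivial_monoids"
proof -
  obtain N f where N: "N \<in> fin_monoids" and f: "f \<in> iso M N"
    using nat_copy[OF assms(1)] .
  obtain g where g: "g \<in> iso N M" using iso_inverse[of M f N] assms(1) f by blast
  have "g \<in> monoid_homs N M"
    using epi_monoid_homs[OF _ _ iso_epi[OF g]] N assms(1) by (simp add: fin_monoids_def)
  then have "R_trivial N"
    using R_trivial_sub[OF assms(2)] g N by (auto simp: iso_def bij_betw_def fin_monoids_def)
  then show ?thesis
    using N f unfolding belongs_to_def is_iso_def fin_monoids_iff
    by (intro bexI[of _ N]) (auto simp: R_trivial_monoids_iff)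
qed

text \<open>Arbitrary lifts of \<open>x\<close>, \<open>s\<close>, \<open>t\<close> need not satisfy
  the lifted equation. Multiplying the lift of \<open>x\<close> by an idempotent power of
  \<open>s' t'\<close> repairs this: the result still maps to \<open>x\<close>, and right
  multiplication by \<open>s'\<close> can be undone on it.\<close>

lemma R_trivial_epi:
  assumes M: "fin_monoid M" "R_trivial M" and N: "monoid N" and f: "f \<in> epi M N"
  shows "R_trivial N"
  unfolding R_trivial_def
proof (intro ballI impI)
  interpret M: monoid M using M by simp
  interpret N: monoid N by fact
  have fh: "f \<in> monoid_homs M N" using epi_monoid_homs[OF M.monoid_axioms N f] .
  note f_simps = monoid_homsD[OF fh] nat_pow_monoid_homs[OF M.monoid_axioms fh]
  fix x s t assume *: "x \<in> carrier N" "s \<in> carrier N" "t \<in> carrier N" "x \<otimes>\<^bsub>N\<^esub> s \<otimes>\<^bsub>N\<^esub> t = x"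
  obtain x' where x': "x' \<in> carrier M" "f x' = x" using epi_surj[OF f *(1)] .
  obtain s' where s': "s' \<in> carrier M" "f s' = s" using epi_surj[OF f *(2)] .
  obtain t' where t': "t' \<in> carrier M" "f t' = t" using epi_surj[OF f *(3)] .
  define a where "a = s' \<otimes>\<^bsub>M\<^esub> t'"
  have a: "a \<in> carrier M" using s' t' by (simp add: a_def)
  obtain n :: nat where n: "n > 0" "a [^]\<^bsub>M\<^esub> n \<otimes>\<^bsub>M\<^esub> a [^]\<^bsub>M\<^esub> n = a [^]\<^bsub>M\<^esub> n"
    using M.idempotent_power[OF _ a] M by blast
  obtain k where k: "n = Suc k" using n(1) by (cases n) auto
  define y where "y = x' \<otimes>\<^bsub>M\<^esub> a [^]\<^bsub>M\<^esub> n"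
  have y: "y \<in> carrier M" using x' a by (simp add: y_def)
  have fa: "x \<otimes>\<^bsub>N\<^esub> f a = x"
    using * s' t' by (simp add: a_def f_simps N.m_assoc)
  have fa': "f a \<in> carrier N" using a by (rule f_simps)
  have "x \<otimes>\<^bsub>N\<^esub> f a [^]\<^bsub>N\<^esub> i = x" for i :: nat
    using fa * fa' by (induction i) (simp_all flip: N.m_assoc)
  then have fy: "f y = x"
    using x' a by (simp add: y_def f_simps)
  have "a [^]\<^bsub>M\<^esub> n = s' \<otimes>\<^bsub>M\<^esub> t' \<otimes>\<^bsub>M\<^esub> a [^]\<^bsub>M\<^esub> k"
    using a k M.nat_pow_Suc2 by (simp add: a_def)
  then have "y \<otimes>\<^bsub>M\<^esub> s' \<otimes>\<^bsub>M\<^esub> (t' \<otimes>\<^bsub>M\<^esub> a [^]\<^bsub>M\<^esub> k) = y \<otimes>\<^bsub>M\<^esub> a [^]\<^bsub>M\<^esub> n"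
    using y s' t' a by (simp add: M.m_assoc)
  also have "\<dots> = y" using n x' a by (simp add: y_def M.m_assoc)
  finally have "y \<otimes>\<^bsub>M\<^esub> s' = y"
    using R_trivialD[OF M(2) y, of s' "t' \<otimes>\<^bsub>M\<^esub> a [^]\<^bsub>M\<^esub> k"] s' t' a by simp
  then show "x \<otimes>\<^bsub>N\<^esub> s = x"
    using fy y s' f_simps(2)[of y s'] by simp
qed

lemma variety_R_trivial: "variety R_trivial_monoids"
  unfolding variety_def
proof (intro conjI ballI allI impI)
  show "R_trivial_monoids \<subseteq> fin_monoids"
    by (auto simp: R_trivial_monoids_def)
  show "M\<lparr>carrier := H\<rparr> \<in> R_trivial_monoids" if M: "M \<in> R_trivial_monoids" and H: "submonoid H M" for M H
  proof -
    have "monoid (M\<lparr>carrier := H\<rparr>)"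
      using M H by (simp add: R_trivial_monoids_iff submonoid.submonoid_is_monoid)
    moreover have "finite H" "H \<subseteq> carrier M"
      using M H finite_subset by (auto simp: R_trivial_monoids_iff submonoid_def)
    ultimately show ?thesis
      using M by (auto simp: R_trivial_monoids_iff R_trivial_def)
  qed
  show "N \<in> R_trivial_monoids"
    if "M \<in> R_trivial_monoids" "N \<in> fin_monoids" "epi M N \<noteq> {}" for M N
    using that R_trivial_epi[of M N] by (auto simp: R_trivial_monoids_iff fin_monoids_iff)
  show "belongs_to (product_group {..<n} M) R_trivial_monoids"
    if M: "\<forall>i<n. M i \<in> R_trivial_monoids" for n :: nat and M
  proof (rule belongs_to_R_trivial)
    show "fin_monoid (product_group {..<n} M)"
      using M by (auto intro!: monoid_product_group finite_PiE simp: R_trivial_monoids_iff)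
    show "R_trivial (product_group {..<n} M)"
      unfolding R_trivial_def
    proof (intro ballI impI)
      let ?P = "product_group {..<n} M"
      fix x s t assume *: "x \<in> carrier ?P" "s \<in> carrier ?P" "t \<in> carrier ?P"
        and eq: "x \<otimes>\<^bsub>?P\<^esub> s \<otimes>\<^bsub>?P\<^esub> t = x"
      have "x i \<otimes>\<^bsub>M i\<^esub> s i = x i" if "i < n" for i
        using fun_cong[OF eq, of i] that M * by (auto simp: R_trivial_monoids_iff PiE_iff intro: R_trivialD)
      then show "x \<otimes>\<^bsub>?P\<^esub> s = x"
        using * by (auto simp: PiE_iff extensional_def fun_eq_iff)
    qed
  qed
qed

section \<open>The operation \<open>K_malcev\<close>\<close>

lemma sim_K_witness:
  assumes "monoid M" "x \<in> carrier M" "y \<in> carrier M"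
  shows "(x, y) \<in> sim_K M \<longleftrightarrow>
    (\<forall>e\<in>carrier M. \<forall>w\<in>carrier M. e \<otimes>\<^bsub>M\<^esub> e = e \<longrightarrow>
      e \<otimes>\<^bsub>M\<^esub> x \<otimes>\<^bsub>M\<^esub> w = e \<or> e \<otimes>\<^bsub>M\<^esub> y \<otimes>\<^bsub>M\<^esub> w = e \<longrightarrow> e \<otimes>\<^bsub>M\<^esub> x = e \<otimes>\<^bsub>M\<^esub> y)"
  using assms by (auto simp: sim_K_def idempotents_def green_R_idem_iff)

lemma sim_K_cancel:
  assumes "monoid M" "(x, y) \<in> sim_K M" "e \<in> carrier M" "w \<in> carrier M" "e \<otimes>\<^bsub>M\<^esub> e = e"
    and "e \<otimes>\<^bsub>M\<^esub> x \<otimes>\<^bsub>M\<^esub> w = e \<or> e \<otimes>\<^bsub>M\<^esub> y \<otimes>\<^bsub>M\<^esub> w = e"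
  shows "e \<otimes>\<^bsub>M\<^esub> x = e \<otimes>\<^bsub>M\<^esub> y"
  using assms sim_K_witness[of M x y] sim_K_carrier[of x y M] by blast

lemma sim_K_equiv: "monoid M \<Longrightarrow> equiv (carrier M) (sim_K M)"
  using sim_K_congruence by (auto simp: monoid_congruence_def)

lemma sim_K_sym: "monoid M \<Longrightarrow> (x, y) \<in> sim_K M \<Longrightarrow> (y, x) \<in> sim_K M"
  using sim_K_equiv by (metis equiv_def symD)

text \<open>An idempotent \<open>e\<close> with \<open>e x\<close> in its \<open>\<R>\<close>-class lifts to such an idempotent: among the
  idempotents above \<open>e\<close>, take one generating a minimal right ideal.\<close>

lemma sim_K_epi:
  assumes M: "fin_monoid M" and N: "monoid N" and f: "f \<in> epi M N" and xy: "(x, y) \<in> sim_K M"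
  shows "(f x, f y) \<in> sim_K N"
proof -
  interpret M: monoid M using M by simp
  interpret N: monoid N by fact
  have fh: "f \<in> monoid_homs M N" using epi_monoid_homs[OF M.monoid_axioms N f] .
  note f_simps = monoid_homsD[OF fh] nat_pow_monoid_homs[OF M.monoid_axioms fh]
  have key: "e \<otimes>\<^bsub>N\<^esub> f x = e \<otimes>\<^bsub>N\<^esub> f y"
    if xy: "(x, y) \<in> sim_K M" and e: "e \<in> carrier N" "e \<otimes>\<^bsub>N\<^esub> e = e"
      and w: "w \<in> carrier N" "e \<otimes>\<^bsub>N\<^esub> f x \<otimes>\<^bsub>N\<^esub> w = e" for x y e w
  proof -
    have x: "x \<in> carrier M" and y: "y \<in> carrier M" using sim_K_carrier[OF xy] by auto
    define T where "T = {g \<in> carrier M. g \<otimes>\<^bsub>M\<^esub> g = g \<and> f g = e}"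
    have pow: "\<exists>n::nat. a [^]\<^bsub>M\<^esub> Suc n \<in> T" if a: "a \<in> carrier M" "f a = e" for a
    proof -
      obtain n :: nat where n: "n > 0" "a [^]\<^bsub>M\<^esub> n \<otimes>\<^bsub>M\<^esub> a [^]\<^bsub>M\<^esub> n = a [^]\<^bsub>M\<^esub> n"
        using M.idempotent_power[OF _ a(1)] M by blast
      have "f (a [^]\<^bsub>M\<^esub> n) = e"
        using a n e by (simp add: f_simps N.idempotent_nat_pow)
      then have "a [^]\<^bsub>M\<^esub> n \<in> T" using n a by (simp add: T_def)
      then show ?thesis using n(1) by (metis Suc_pred)
    qed
    obtain a where "a \<in> carrier M" "f a = e" using epi_surj[OF f e(1)] .
    then have "T \<noteq> {}" using pow by blast
    then obtain g where g: "g \<in> T"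
      and min: "\<And>h. h \<in> T \<Longrightarrow> card (g <#\<^bsub>M\<^esub> carrier M) \<le> card (h <#\<^bsub>M\<^esub> carrier M)"
      using ex_has_least_nat[of "\<lambda>h. h \<in> T" _ "\<lambda>h. card (h <#\<^bsub>M\<^esub> carrier M)"] by blast
    have gM: "g \<in> carrier M" "g \<otimes>\<^bsub>M\<^esub> g = g" "f g = e" using g by (auto simp: T_def)
    obtain v where v: "v \<in> carrier M" "f v = w" using epi_surj[OF f w(1)] .
    \<comment> \<open>\<open>b\<close> maps to \<open>e f(x) w e = e\<close>, so some power of it is
      an idempotent above \<open>e\<close>; that power starts with \<open>g x\<close>, hence its
      right ideal lies inside that of \<open>g\<close>.\<close>
    define b where "b = g \<otimes>\<^bsub>M\<^esub> x \<otimes>\<^bsub>M\<^esub> v \<otimes>\<^bsub>M\<^esub> g"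
    have b: "b \<in> carrier M" using gM x v by (simp add: b_def)
    have "f b = e" using gM x v w e by (simp add: b_def f_simps)
    then obtain n :: nat where n: "b [^]\<^bsub>M\<^esub> Suc n \<in> T" using pow b by blast
    define h where "h = b [^]\<^bsub>M\<^esub> Suc n"
    have h: "h = b \<otimes>\<^bsub>M\<^esub> b [^]\<^bsub>M\<^esub> n" "h \<in> carrier M"
      using M.nat_pow_Suc2[OF b] b by (simp_all add: h_def)
    have hg: "h = g \<otimes>\<^bsub>M\<^esub> x \<otimes>\<^bsub>M\<^esub> (v \<otimes>\<^bsub>M\<^esub> g \<otimes>\<^bsub>M\<^esub> b [^]\<^bsub>M\<^esub> n)"
      using b gM x v by (simp add: h(1) M.m_assoc b_def)
    define c where "c = v \<otimes>\<^bsub>M\<^esub> g \<otimes>\<^bsub>M\<^esub> b [^]\<^bsub>M\<^esub> n"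
    have c: "c \<in> carrier M" using b gM v by (simp add: c_def)
    have hgc: "h = g \<otimes>\<^bsub>M\<^esub> x \<otimes>\<^bsub>M\<^esub> c" using hg by (simp add: c_def)
    have "h \<otimes>\<^bsub>M\<^esub> z \<in> g <#\<^bsub>M\<^esub> carrier M" if "z \<in> carrier M" for z
    proof -
      have "h \<otimes>\<^bsub>M\<^esub> z = g \<otimes>\<^bsub>M\<^esub> (x \<otimes>\<^bsub>M\<^esub> c \<otimes>\<^bsub>M\<^esub> z)"
        using that gM x c by (simp add: hgc M.m_assoc)
      then show ?thesis using that x c unfolding l_coset_def by blast
    qed
    then have sub: "h <#\<^bsub>M\<^esub> carrier M \<subseteq> g <#\<^bsub>M\<^esub> carrier M"
      unfolding l_coset_def by blast
    have "finite (g <#\<^bsub>M\<^esub> carrier M)" using M by (simp add: l_coset_def)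
    then have "h <#\<^bsub>M\<^esub> carrier M = g <#\<^bsub>M\<^esub> carrier M"
      using sub min[of h] n by (simp add: h_def card_seteq)
    moreover have "g \<in> g <#\<^bsub>M\<^esub> carrier M"
      using gM unfolding l_coset_def by blast
    \<comment> \<open>By minimality the two ideals agree. So \<open>g = h d = g x c d\<close>, which
      makes \<open>g x\<close> \<R>-equivalent to \<open>g\<close> and brings the hypothesis on
      \<open>x\<close> and \<open>y\<close> into play.\<close>
    ultimately obtain d where d: "d \<in> carrier M" "g = h \<otimes>\<^bsub>M\<^esub> d"
      unfolding l_coset_def by blast
    then have "g \<otimes>\<^bsub>M\<^esub> x \<otimes>\<^bsub>M\<^esub> (c \<otimes>\<^bsub>M\<^esub> d) = g"
      using gM x c by (simp add: hgc M.m_assoc)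
    then have "g \<otimes>\<^bsub>M\<^esub> x = g \<otimes>\<^bsub>M\<^esub> y"
      using sim_K_cancel[OF M.monoid_axioms xy gM(1) M.m_closed[OF c d(1)] gM(2)] by blast
    then have "f (g \<otimes>\<^bsub>M\<^esub> x) = f (g \<otimes>\<^bsub>M\<^esub> y)" by simp
    then show ?thesis using gM x y by (simp add: f_simps)
  qed
  have yx: "(y, x) \<in> sim_K M" using M.monoid_axioms xy by (rule sim_K_sym)
  have "f x \<in> carrier N" "f y \<in> carrier N"
    using sim_K_carrier[OF xy] by (simp_all add: f_simps)
  then show ?thesis
    unfolding sim_K_witness[OF N \<open>f x \<in> carrier N\<close> \<open>f y \<in> carrier N\<close>]
    using key[OF xy] key[OF yx, symmetric] by blast
qed

section \<open>Quotients by \<open>\<sim>\<^sub>K\<close> and membership in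
  \<open>K_malcev\<close>\<close>

lemma quotient_epi:
  assumes M: "fin_monoid M"
  defines "Q \<equiv> quotient_monoid M (sim_K M)"
  shows "fin_monoid Q" "(\<lambda>x. sim_K M `` {x}) \<in> epi M Q"
proof -
  interpret M: monoid M using M by simp
  have Q: "carrier Q = carrier M // sim_K M" "\<one>\<^bsub>Q\<^esub> = sim_K M `` {\<one>\<^bsub>M\<^esub>}"
    by (simp_all add: Q_def quotient_monoid_def)
  have m: "sim_K M `` {x} \<otimes>\<^bsub>Q\<^esub> sim_K M `` {y} = sim_K M `` {x \<otimes>\<^bsub>M\<^esub> y}"
    if "x \<in> carrier M" "y \<in> carrier M" for x y
    unfolding Q_def
    using quotient_monoid_mult[OF M.monoid_axioms sim_K_congruence[OF M.monoid_axioms] that] .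
  have c: "sim_K M `` {x} \<in> carrier Q" if "x \<in> carrier M" for x
    using that by (simp add: Q quotientI)
  have r: "\<exists>x\<in>carrier M. X = sim_K M `` {x}" if "X \<in> carrier Q" for X
    using that by (auto simp: Q elim: quotientE)
  have "monoid Q"
  proof (rule monoidI)
    show "\<one>\<^bsub>Q\<^esub> \<in> carrier Q" using c by (simp add: Q(2))
    fix X Y Z assume "X \<in> carrier Q" "Y \<in> carrier Q" "Z \<in> carrier Q"
    then obtain x y z where *: "x \<in> carrier M" "y \<in> carrier M" "z \<in> carrier M"
      "X = sim_K M `` {x}" "Y = sim_K M `` {y}" "Z = sim_K M `` {z}"
      using r by metis
    then show "X \<otimes>\<^bsub>Q\<^esub> Y \<in> carrier Q" "X \<otimes>\<^bsub>Q\<^esub> Y \<otimes>\<^bsub>Q\<^esub> Z = X \<otimes>\<^bsub>Q\<^esub> (Y \<otimes>\<^bsub>Q\<^esub> Z)"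
      by (simp_all add: m c M.m_assoc)
    from * show "\<one>\<^bsub>Q\<^esub> \<otimes>\<^bsub>Q\<^esub> X = X" "X \<otimes>\<^bsub>Q\<^esub> \<one>\<^bsub>Q\<^esub> = X"
      by (simp_all add: m Q(2))
  qed
  moreover have "finite (carrier Q)"
    using M sim_K_equiv[of M] by (auto simp: Q intro: finite_quotient dest: equiv_type)
  ultimately show "fin_monoid Q" by simp
  show "(\<lambda>x. sim_K M `` {x}) \<in> epi M Q"
  proof (rule epiI)
    show "(\<lambda>x. sim_K M `` {x}) \<in> monoid_homs M Q"
      by (rule monoid_homsI) (simp_all add: c m Q(2))
    show "\<exists>x\<in>carrier M. sim_K M `` {x} = X" if "X \<in> carrier Q" for X
      using r[OF that] by metis
  qed
qed

text \<open>If the kernel of \<open>\<psi>\<close> is finer than \<open>\<sim>\<^sub>K\<close>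
  pulled back along \<open>\<gamma>\<close>, then the quotient by \<open>\<sim>\<^sub>K\<close>
  divides \<open>Q\<close>. This gives membership without computing \<open>\<sim>\<^sub>K\<close>
  exactly.\<close>

lemma K_malcevI:
  assumes V: "variety V" and S: "monoid S" and M: "fin_monoid M" and \<gamma>: "\<gamma> \<in> epi S M"
    and \<psi>: "\<psi> \<in> monoid_homs S Q" and Q: "monoid Q" "belongs_to Q V"
    and ker: "\<And>a b. a \<in> carrier S \<Longrightarrow> b \<in> carrier S \<Longrightarrow> \<psi> a = \<psi> b \<Longrightarrow> (\<gamma> a, \<gamma> b) \<in> sim_K M"
  shows "belongs_to M (K_malcev V)"
proof -
  obtain N f where N: "N \<in> fin_monoids" and f: "f \<in> iso M N"
    using nat_copy[OF M] .
  have fN: "fin_monoid N" using N by (simp add: fin_monoids_iff)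
  then have mN: "monoid N" by simp
  let ?q = "\<lambda>x. sim_K N `` {x}"
  have "(?q \<circ> (f \<circ> \<gamma>)) \<in> epi S (quotient_monoid N (sim_K N))"
    using epi_compose[OF epi_compose[OF \<gamma> iso_epi[OF f]] quotient_epi(2)[OF fN]] .
  moreover have "(?q \<circ> (f \<circ> \<gamma>)) a = (?q \<circ> (f \<circ> \<gamma>)) b"
    if "a \<in> carrier S" "b \<in> carrier S" "\<psi> a = \<psi> b" for a b
  proof -
    have "(f (\<gamma> a), f (\<gamma> b)) \<in> sim_K N"
      using sim_K_epi[OF M mN iso_epi[OF f] ker[OF that]] .
    then show ?thesis using equiv_class_eq[OF sim_K_equiv[OF mN]] by simp
  qed
  ultimately have "belongs_to (quotient_monoid N (sim_K N)) V"
    using variety_divisor[OF V Q(2,1) S \<psi> _ quotient_epi(1)[OF fN]] by blast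
  then have "N \<in> K_malcev V" using N by (simp add: K_malcev_def)
  then show ?thesis using f unfolding belongs_to_def is_iso_def by blast
qed

text \<open>\<open>\<psi>\<close> is the projection onto the quotient, transported along
  isomorphisms; \<open>sim_K_epi\<close>, applied to the inverse isomorphism, brings
  \<open>\<sim>\<^sub>K\<close> back to \<open>M\<close>.\<close>

lemma K_malcevE:
  assumes V: "variety V" and M: "fin_monoid M" "belongs_to M (K_malcev V)"
  obtains Q \<psi> where "Q \<in> V" "\<psi> \<in> monoid_homs M Q"
    "\<And>a b. a \<in> carrier M \<Longrightarrow> b \<in> carrier M \<Longrightarrow> \<psi> a = \<psi> b \<Longrightarrow> (a, b) \<in> sim_K M"
proof -
  obtain N f where N: "N \<in> K_malcev V" and f: "f \<in> iso M N"
    using M(2) by (auto simp: belongs_to_def is_iso_def)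
  have mM: "monoid M" using M by simp
  have fN: "fin_monoid N" using N by (simp add: K_malcev_def fin_monoids_def)
  then have mN: "monoid N" by simp
  let ?R = "quotient_monoid N (sim_K N)" and ?q = "\<lambda>x. sim_K N `` {x}"
  obtain Q h where Q: "Q \<in> V" and h: "h \<in> iso ?R Q"
    using N by (auto simp: K_malcev_def belongs_to_def is_iso_def)
  obtain g where g: "g \<in> iso N M" "\<And>x. x \<in> carrier M \<Longrightarrow> g (f x) = x"
    using iso_inverse[OF mM f] by metis
  let ?\<psi> = "h \<circ> (?q \<circ> f)"
  have "?\<psi> \<in> epi M Q"
    using epi_compose[OF epi_compose[OF iso_epi[OF f] quotient_epi(2)[OF fN]] iso_epi[OF h]] .
  then have "?\<psi> \<in> monoid_homs M Q"
    using epi_monoid_homs[OF mM] variety_fin_monoid[OF V Q] by blast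
  moreover have "(a, b) \<in> sim_K M" if ab: "a \<in> carrier M" "b \<in> carrier M" "?\<psi> a = ?\<psi> b" for a b
  proof -
    have fab: "f a \<in> carrier N" "f b \<in> carrier N"
      using ab f by (auto simp: iso_def hom_def)
    then have "?q (f a) \<in> carrier ?R" "?q (f b) \<in> carrier ?R"
      by (simp_all add: quotient_monoid_def quotientI)
    then have "?q (f a) = ?q (f b)"
      using ab(3) h by (auto simp: iso_def bij_betw_def inj_on_def)
    then have "(f a, f b) \<in> sim_K N"
      using eq_equiv_class_iff[OF sim_K_equiv[OF mN]] fab by blast
    from sim_K_epi[OF fN mM iso_epi[OF g(1)] this] show ?thesis
      using g(2) ab by simp
  qed
  ultimately show ?thesis using that Q by blast
qed

lemma sim_K_refl: "x \<in> carrier M \<Longrightarrow> (x, x) \<in> sim_K M"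
  by (simp add: sim_K_def)

text \<open>In each case a homomorphism with kernel inside \<open>\<sim>\<^sub>K\<close> is built
  from given ones: by restriction for submonoids, with the same map for images, and componentwise
  for products.\<close>

lemma variety_K_malcev:
  assumes V: "variety V"
  shows "variety (K_malcev V)"
proof -
  have fin: "K_malcev V \<subseteq> fin_monoids" by (auto simp: K_malcev_def)
  \<comment> \<open>\<open>belongs_to_nat\<close> presupposes a variety, so closure under
    isomorphism has to be shown by hand first.\<close>
  have iso_closed: "M \<in> K_malcev V" if bt: "belongs_to M (K_malcev V)" and M: "fin_monoid M" for M
  proof -
    obtain Q \<psi> where Q: "Q \<in> V" and \<psi>: "\<psi> \<in> monoid_homs M Q"
      and ker: "\<And>a b. a \<in> carrier M \<Longrightarrow> b \<in> carrier M \<Longrightarrow> \<psi> a = \<psi> b \<Longrightarrow> (a, b) \<in> sim_K M"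
      using K_malcevE[OF V M bt] by metis
    have "?thesis \<longleftrightarrow> belongs_to (quotient_monoid M (sim_K M)) V"
      using M by (simp add: K_malcev_def fin_monoids_def)
    moreover have "belongs_to (quotient_monoid M (sim_K M)) V"
    proof -
      have mM: "monoid M" and mQ: "monoid Q" using M variety_fin_monoid[OF V Q] by simp_all
      have "sim_K M `` {a} = sim_K M `` {b}"
        if "a \<in> carrier M" "b \<in> carrier M" "\<psi> a = \<psi> b" for a b
        using equiv_class_eq[OF sim_K_equiv[OF mM] ker[OF that]] .
      then show ?thesis
        using variety_divisor[OF V belongs_to_refl[OF Q] mQ mM \<psi> quotient_epi(2)[OF M]
            quotient_epi(1)[OF M]] by blast
    qed
    ultimately show ?thesis by simp
  qed
  show ?thesis
    unfolding variety_def
  proof (intro conjI ballI allI impI)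
    show "K_malcev V \<subseteq> fin_monoids" by (rule fin)
    show "M\<lparr>carrier := H\<rparr> \<in> K_malcev V" if M: "M \<in> K_malcev V" and H: "submonoid H M" for M H
    proof (rule iso_closed)
      let ?H = "M\<lparr>carrier := H\<rparr>"
      have fM: "fin_monoid M" using M fin by (auto simp: fin_monoids_def)
      have HM: "H \<subseteq> carrier M" using H by (simp add: submonoid_def)
      show fH: "fin_monoid ?H"
        using fM H HM finite_subset by (auto intro: submonoid.submonoid_is_monoid)
      obtain Q \<psi> where Q: "Q \<in> V" and \<psi>: "\<psi> \<in> monoid_homs M Q"
        and ker: "\<And>a b. a \<in> carrier M \<Longrightarrow> b \<in> carrier M \<Longrightarrow> \<psi> a = \<psi> b \<Longrightarrow> (a, b) \<in> sim_K M"
        using K_malcevE[OF V fM belongs_to_refl[OF M]] by metis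
      have "\<psi> \<in> monoid_homs ?H Q"
        using \<psi> HM by (auto simp: monoid_homs_def hom_def)
      moreover have "(a, b) \<in> sim_K ?H" if ab: "a \<in> carrier ?H" "b \<in> carrier ?H" "\<psi> a = \<psi> b" for a b
      proof -
        have c: "a \<in> carrier M" "b \<in> carrier M" using ab HM by auto
        \<comment> \<open>An idempotent and a witness taken from \<open>H\<close> are also available
          in \<open>M\<close>, so \<open>\<sim>\<^sub>K\<close> of \<open>M\<close>, restricted to
          \<open>H\<close>, is contained in \<open>\<sim>\<^sub>K\<close> of
          \<open>H\<close>.\<close>
        have "e \<otimes>\<^bsub>M\<^esub> a = e \<otimes>\<^bsub>M\<^esub> b"
          if "e \<in> H" "w \<in> H" "e \<otimes>\<^bsub>M\<^esub> e = e" "e \<otimes>\<^bsub>M\<^esub> a \<otimes>\<^bsub>M\<^esub> w = e \<or> e \<otimes>\<^bsub>M\<^esub> b \<otimes>\<^bsub>M\<^esub> w = e" for e w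
          using sim_K_cancel[OF _ ker[OF c ab(3)], of e w] that HM fM by auto
        then show ?thesis
          using sim_K_witness[of ?H a b] ab fH by auto
      qed
      ultimately show "belongs_to ?H (K_malcev V)"
        using K_malcevI[OF V _ fH id_epi _ _ belongs_to_refl[OF Q]] fH variety_fin_monoid[OF V Q]
        by blast
    qed
    show "N \<in> K_malcev V" if M: "M \<in> K_malcev V" and N: "N \<in> fin_monoids" and "epi M N \<noteq> {}" for M N
    proof (rule iso_closed)
      have fM: "fin_monoid M" using M fin by (auto simp: fin_monoids_def)
      show fN: "fin_monoid N" using N by (simp add: fin_monoids_def)
      obtain f where f: "f \<in> epi M N" using \<open>epi M N \<noteq> {}\<close> by blast
      obtain Q \<psi> where Q: "Q \<in> V" and \<psi>: "\<psi> \<in> monoid_homs M Q"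
        and ker: "\<And>a b. a \<in> carrier M \<Longrightarrow> b \<in> carrier M \<Longrightarrow> \<psi> a = \<psi> b \<Longrightarrow> (a, b) \<in> sim_K M"
        using K_malcevE[OF V fM belongs_to_refl[OF M]] by metis
      have "(f a, f b) \<in> sim_K N" if "a \<in> carrier M" "b \<in> carrier M" "\<psi> a = \<psi> b" for a b
        using sim_K_epi[OF fM _ f ker[OF that]] fN by blast
      then show "belongs_to N (K_malcev V)"
        using K_malcevI[OF V _ fN f \<psi> _ belongs_to_refl[OF Q]] fM variety_fin_monoid[OF V Q] by blast
    qed
    show "belongs_to (product_group {..<n} M) (K_malcev V)"
      if M: "\<forall>i<n. M i \<in> K_malcev V" for n :: nat and M
    proof -
      let ?P = "product_group {..<n} M"
      have fM: "fin_monoid (M i)" if "i < n" for i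
        using that M fin by (auto simp: fin_monoids_def)
      have fP: "fin_monoid ?P"
        using fM by (auto intro!: monoid_product_group finite_PiE)
      have "\<exists>Q \<psi>. Q \<in> V \<and> \<psi> \<in> monoid_homs (M i) Q \<and>
          (\<forall>a\<in>carrier (M i). \<forall>b\<in>carrier (M i). \<psi> a = \<psi> b \<longrightarrow> (a, b) \<in> sim_K (M i))" if "i < n" for i
        using K_malcevE[OF V fM[OF that] belongs_to_refl] M that by metis
      then obtain Q \<psi> where Q: "\<And>i. i < n \<Longrightarrow> Q i \<in> V"
        and \<psi>: "\<And>i. i < n \<Longrightarrow> \<psi> i \<in> monoid_homs (M i) (Q i)"
        and ker: "\<And>i a b. i < n \<Longrightarrow> a \<in> carrier (M i) \<Longrightarrow> b \<in> carrier (M i) \<Longrightarrow>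
          \<psi> i a = \<psi> i b \<Longrightarrow> (a, b) \<in> sim_K (M i)"
        by metis
      let ?Q = "product_group {..<n} Q"
      define \<theta> where "\<theta> x = (\<lambda>i\<in>{..<n}. \<psi> i (x i))" for x
      have mQ: "monoid ?Q"
        using variety_fin_monoid[OF V Q] by (intro monoid_product_group) auto
      have \<theta>: "\<theta> \<in> monoid_homs ?P ?Q"
        using monoid_homsD[OF \<psi>] by (intro monoid_homsI) (auto simp: \<theta>_def PiE_iff intro!: restrict_ext)
      have "(a, b) \<in> sim_K ?P"
        if a: "a \<in> carrier ?P" and b: "b \<in> carrier ?P" and eq: "\<theta> a = \<theta> b" for a b
      proof -
        have ab: "(a i, b i) \<in> sim_K (M i)" if "i < n" for i
          using that a b fun_cong[OF eq, of i] by (intro ker) (auto simp: \<theta>_def PiE_iff)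
        have "e \<otimes>\<^bsub>?P\<^esub> a = e \<otimes>\<^bsub>?P\<^esub> b"
          if "e \<in> carrier ?P" "w \<in> carrier ?P" "e \<otimes>\<^bsub>?P\<^esub> e = e"
            and ew: "e \<otimes>\<^bsub>?P\<^esub> a \<otimes>\<^bsub>?P\<^esub> w = e \<or> e \<otimes>\<^bsub>?P\<^esub> b \<otimes>\<^bsub>?P\<^esub> w = e" for e w
        proof -
          have "e i \<otimes>\<^bsub>M i\<^esub> a i = e i \<otimes>\<^bsub>M i\<^esub> b i" if i: "i < n" for i
          proof -
            have c: "e i \<in> carrier (M i)" "w i \<in> carrier (M i)" "a i \<in> carrier (M i)" "b i \<in> carrier (M i)"
              using i a b \<open>e \<in> carrier ?P\<close> \<open>w \<in> carrier ?P\<close> by (auto simp: PiE_iff)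
            have "e i \<otimes>\<^bsub>M i\<^esub> e i = e i"
              using fun_cong[OF \<open>e \<otimes>\<^bsub>?P\<^esub> e = e\<close>, of i] i by simp
            moreover have "e i \<otimes>\<^bsub>M i\<^esub> a i \<otimes>\<^bsub>M i\<^esub> w i = e i \<or> e i \<otimes>\<^bsub>M i\<^esub> b i \<otimes>\<^bsub>M i\<^esub> w i = e i"
              using ew i by (auto dest!: fun_cong[of _ _ i])
            ultimately show ?thesis
              using sim_K_cancel[OF _ ab[OF i] c(1,2)] fM[OF i] by blast
          qed
          then show ?thesis by (auto intro: restrict_ext)
        qed
        then show ?thesis using fP sim_K_witness[OF _ a b] by blast
      qed
      then show ?thesis
        using K_malcevI[OF V _ fP id_epi \<theta> mQ belongs_to_product[OF V Q]] fP by blast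
    qed
  qed
qed

text \<open>Equality is contained in \<open>\<sim>\<^sub>K\<close>, so the identity map serves as
  \<open>\<psi>\<close>.\<close>

lemma variety_le_K_malcev:
  assumes V: "variety V"
  shows "V \<subseteq> K_malcev V"
proof
  fix M assume M: "M \<in> V"
  then have fM: "fin_monoid M" using variety_fin_monoid[OF V] by blast
  then have "belongs_to M (K_malcev V)"
    using epi_monoid_homs[OF _ _ id_epi, of M] sim_K_refl
    by (intro K_malcevI[OF V _ fM id_epi _ _ belongs_to_refl[OF M]]) auto
  then show "M \<in> K_malcev V" using belongs_to_nat[OF variety_K_malcev[OF V]] fM by blast
qed

lemma K_malcev_mono: "V \<subseteq> W \<Longrightarrow> K_malcev V \<subseteq> K_malcev W"
  by (auto simp: K_malcev_def belongs_to_def)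

lemma belongs_to_mono: "V \<subseteq> W \<Longrightarrow> belongs_to M V \<Longrightarrow> belongs_to M W"
  by (auto simp: belongs_to_def)

section \<open>The hierarchy\<close>

lemma D_malcev_opposite: "D_malcev V = opposite_class (K_malcev (opposite_class V))"
proof -
  have "set_mult (opposite_monoid M) X Y = set_mult M Y X" for M :: "nat monoid" and X Y
    by (auto simp: set_mult_def)
  then have "quotient_monoid (opposite_monoid M) r = opposite_monoid (quotient_monoid M r)"
    for M :: "nat monoid" and r
    by (simp add: quotient_monoid_def opposite_monoid_def)
  then show ?thesis
    by (auto simp: D_malcev_def K_malcev_def belongs_to_opposite_class sim_D_eq_sim_K_opposite)
qed

lemma TW_L_opposite: "TW_L (Suc (Suc k)) = opposite_class (TW_R (Suc (Suc k)))"
proof (induction k)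
  case 0
  show ?case by (simp only: TW_R.simps TW_L.simps L_trivial_monoids_opposite)
next
  case (Suc k)
  then show ?case
    by (simp only: TW_R.simps TW_L.simps D_malcev_opposite)
qed

lemma TW_R_Suc: "TW_R (Suc (Suc (Suc k))) = K_malcev (opposite_class (TW_R (Suc (Suc k))))"
  by (simp only: TW_R.simps TW_L_opposite)

lemma variety_TW_R: "variety (TW_R (Suc (Suc k)))"
  by (induction k)
    (simp_all only: TW_R_Suc TW_R.simps(1) variety_R_trivial variety_K_malcev variety_opposite_class)

text \<open>A semilattice of sets, which will receive the stabilisers of elements; for empty
  \<open>A\<close> it is the trivial monoid.\<close>

definition inter_monoid :: "'a set \<Rightarrow> 'a set monoid" where
  "inter_monoid A = \<lparr>carrier = Pow A, mult = (\<inter>), one = A\<rparr>"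

lemma fin_monoid_inter: "finite A \<Longrightarrow> fin_monoid (inter_monoid A)"
  by (auto simp: inter_monoid_def intro!: monoidI)

lemma R_trivial_inter: "R_trivial (inter_monoid A)"
  by (auto simp: R_trivial_def inter_monoid_def)

lemma opposite_inter: "opposite_monoid (inter_monoid A) = inter_monoid A"
  by (auto simp: opposite_monoid_def inter_monoid_def)

text \<open>In an \<open>\<R>\<close>-trivial monoid \<open>x \<sim>\<^sub>K y\<close> says that \<open>x\<close> and \<open>y\<close> stabilise the same idempotents,
  and \<open>e x y = e\<close> forces \<open>e x = e\<close>; so the quotient is a semilattice.\<close>

lemma R_trivial_le_K_malcev:
  "R_trivial_monoids \<subseteq> K_malcev (opposite_class R_trivial_monoids)"
proof
  fix M assume "M \<in> R_trivial_monoids"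
  then have M: "fin_monoid M" and R: "R_trivial M" by (simp_all add: R_trivial_monoids_iff)
  interpret monoid M using M by simp
  let ?E = "idempotents M"
  have E: "finite ?E" using M by (simp add: idempotents_def)
  define \<psi> where "\<psi> x = {e \<in> ?E. e \<otimes>\<^bsub>M\<^esub> x = e}" for x
  have stab: "e \<otimes>\<^bsub>M\<^esub> (x \<otimes>\<^bsub>M\<^esub> y) = e \<longleftrightarrow> e \<otimes>\<^bsub>M\<^esub> x = e \<and> e \<otimes>\<^bsub>M\<^esub> y = e"
    if "e \<in> carrier M" "x \<in> carrier M" "y \<in> carrier M" for e x y
    using R_trivialD[OF R that] that by (auto simp flip: m_assoc)
  have \<psi>: "\<psi> \<in> monoid_homs M (inter_monoid ?E)"
    by (rule monoid_homsI) (auto simp: \<psi>_def inter_monoid_def idempotents_def stab)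
  have "belongs_to (inter_monoid ?E) (opposite_class R_trivial_monoids)"
    unfolding belongs_to_opposite_class opposite_inter
    using fin_monoid_inter[OF E] R_trivial_inter by (rule belongs_to_R_trivial)
  moreover have "(a, b) \<in> sim_K M" if ab: "a \<in> carrier M" "b \<in> carrier M" "\<psi> a = \<psi> b" for a b
  proof -
    have "e \<otimes>\<^bsub>M\<^esub> a = e \<otimes>\<^bsub>M\<^esub> b"
      if e: "e \<in> carrier M" "e \<otimes>\<^bsub>M\<^esub> e = e" and w: "w \<in> carrier M"
        and ew: "e \<otimes>\<^bsub>M\<^esub> a \<otimes>\<^bsub>M\<^esub> w = e \<or> e \<otimes>\<^bsub>M\<^esub> b \<otimes>\<^bsub>M\<^esub> w = e" for e w
    proof -
      have "e \<otimes>\<^bsub>M\<^esub> a = e \<or> e \<otimes>\<^bsub>M\<^esub> b = e"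
        using ew R_trivialD[OF R e(1) ab(1) w] R_trivialD[OF R e(1) ab(2) w] by blast
      moreover have "e \<in> \<psi> a \<longleftrightarrow> e \<in> \<psi> b" using ab(3) by simp
      ultimately show ?thesis using e by (auto simp: \<psi>_def idempotents_def)
    qed
    then show ?thesis using sim_K_witness[OF monoid_axioms ab(1,2)] by blast
  qed
  ultimately have "belongs_to M (K_malcev (opposite_class R_trivial_monoids))"
    using K_malcevI[OF variety_opposite_class[OF variety_R_trivial] monoid_axioms M id_epi \<psi>]
      fin_monoid_inter[OF E] by blast
  then show "M \<in> K_malcev (opposite_class R_trivial_monoids)"
    using belongs_to_nat[OF variety_K_malcev[OF variety_opposite_class[OF variety_R_trivial]]] M
    by blast
qed

text \<open>The base case is the semilattice quotient of \<R>-trivial monoids; afterwards duality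
  and \<open>K_malcev\<close> are both monotone.\<close>

lemma TW_R_le_Suc: "TW_R (Suc (Suc k)) \<subseteq> TW_R (Suc (Suc (Suc k)))"
proof (induction k)
  case 0
  show ?case unfolding TW_R_Suc TW_R.simps(1) by (rule R_trivial_le_K_malcev)
next
  case (Suc k)
  show ?case
    using K_malcev_mono[OF opposite_class_mono[OF Suc]] unfolding TW_R_Suc[symmetric] .
qed

lemma TW_R_opposite_le_Suc: "opposite_class (TW_R (Suc (Suc k))) \<subseteq> TW_R (Suc (Suc (Suc k)))"
  unfolding TW_R_Suc by (intro variety_le_K_malcev variety_opposite_class variety_TW_R)

lemma R_trivial_le_TW_R: "R_trivial_monoids \<subseteq> TW_R (Suc (Suc k))"
proof (induction k)
  case (Suc k)
  then show ?case using TW_R_le_Suc by blast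
qed simp

text \<open>Of the four inclusions two are already known; the other two are their duals, as taking
  opposites twice changes nothing.\<close>

lemma join_le:
  defines "W k \<equiv> TW_R (Suc (Suc k))"
  shows "W k \<union> opposite_class (W k) \<subseteq> W (Suc k) \<inter> opposite_class (W (Suc k))"
  using TW_R_le_Suc[of k] TW_R_opposite_le_Suc[of k]
    opposite_class_mono[OF TW_R_le_Suc[of k]] opposite_class_mono[OF TW_R_opposite_le_Suc[of k]]
  unfolding W_def by auto

section \<open>Identities of the joins\<close>

primrec omega_lhs :: "'a monoid \<Rightarrow> nat \<Rightarrow> 'a \<Rightarrow> (nat \<Rightarrow> 'a) \<Rightarrow> (nat \<Rightarrow> 'a) \<Rightarrow> nat \<Rightarrow> 'a" where
  "omega_lhs M n a x y 0 = a"
| "omega_lhs M n a x y (Suc j) =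
    (omega_lhs M n a x y j \<otimes>\<^bsub>M\<^esub> x j) [^]\<^bsub>M\<^esub> n \<otimes>\<^bsub>M\<^esub> omega_lhs M n a x y j
      \<otimes>\<^bsub>M\<^esub> (y j \<otimes>\<^bsub>M\<^esub> omega_lhs M n a x y j) [^]\<^bsub>M\<^esub> n"

text \<open>The recursion replaces only the middle factor; the outer powers are built from
  \<open>omega_lhs\<close> on both sides. So the two sides differ just by the deletion of one
  central \<open>a\<close>.\<close>

primrec omega_rhs :: "'a monoid \<Rightarrow> nat \<Rightarrow> 'a \<Rightarrow> (nat \<Rightarrow> 'a) \<Rightarrow> (nat \<Rightarrow> 'a) \<Rightarrow> nat \<Rightarrow> 'a" where
  "omega_rhs M n a x y 0 = \<one>\<^bsub>M\<^esub>"
| "omega_rhs M n a x y (Suc j) =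
    (omega_lhs M n a x y j \<otimes>\<^bsub>M\<^esub> x j) [^]\<^bsub>M\<^esub> n \<otimes>\<^bsub>M\<^esub> omega_rhs M n a x y j
      \<otimes>\<^bsub>M\<^esub> (y j \<otimes>\<^bsub>M\<^esub> omega_lhs M n a x y j) [^]\<^bsub>M\<^esub> n"

text \<open>The exponent \<open>n * k\<close> stands for \<open>\<omega>\<close>; allowing all multiples of some \<open>n\<close> makes the property
  stable under finite products without comparing the idempotent powers of the factors.\<close>

definition satisfies :: "nat \<Rightarrow> 'a monoid \<Rightarrow> bool" where
  "satisfies j M \<longleftrightarrow> (\<exists>n>0. \<forall>k>0. \<forall>a\<in>carrier M. \<forall>x y. (\<forall>i. x i \<in> carrier M) \<and> (\<forall>i. y i \<in> carrier M) \<longrightarrow>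
     omega_lhs M (n * k) a x y j = omega_rhs M (n * k) a x y j)"

lemma omega_closed:
  assumes "monoid M" "a \<in> carrier M" "\<And>i. x i \<in> carrier M" "\<And>i. y i \<in> carrier M"
  shows "omega_lhs M n a x y j \<in> carrier M" "omega_rhs M n a x y j \<in> carrier M"
proof -
  interpret monoid M by fact
  show l: "omega_lhs M n a x y j \<in> carrier M" for j
    using assms by (induction j) simp_all
  show "omega_rhs M n a x y j \<in> carrier M"
    using assms l by (induction j) simp_all
qed

lemma omega_hom:
  assumes M: "monoid M" and f: "f \<in> monoid_homs M N"
    and c: "a \<in> carrier M" "\<And>i. x i \<in> carrier M" "\<And>i. y i \<in> carrier M"
  shows "f (omega_lhs M n a x y j) = omega_lhs N n (f a) (\<lambda>i. f (x i)) (\<lambda>i. f (y i)) j"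
    "f (omega_rhs M n a x y j) = omega_rhs N n (f a) (\<lambda>i. f (x i)) (\<lambda>i. f (y i)) j"
proof -
  interpret monoid M by fact
  note cl = omega_closed[OF M, of a x y, OF c] c
  note hom = monoid_homsD[OF f] nat_pow_monoid_homs[OF M f]
  show l: "f (omega_lhs M n a x y j) = omega_lhs N n (f a) (\<lambda>i. f (x i)) (\<lambda>i. f (y i)) j" for j
    by (induction j) (simp_all add: hom cl)
  show "f (omega_rhs M n a x y j) = omega_rhs N n (f a) (\<lambda>i. f (x i)) (\<lambda>i. f (y i)) j"
    by (induction j) (simp_all add: hom cl l)
qed

text \<open>Each level has the palindromic shape \<open>(U x)\<^sup>n U (y U)\<^sup>n\<close>, so
  reading it backwards merely exchanges \<open>x\<close> and \<open>y\<close>. As both range over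
  all sequences, the identities are self-dual.\<close>

lemma omega_opposite:
  assumes "monoid M" "a \<in> carrier M" "\<And>i. x i \<in> carrier M" "\<And>i. y i \<in> carrier M"
  shows "omega_lhs (opposite_monoid M) n a x y j = omega_lhs M n a y x j"
    "omega_rhs (opposite_monoid M) n a x y j = omega_rhs M n a y x j"
proof -
  interpret monoid M by fact
  have p: "b [^]\<^bsub>opposite_monoid M\<^esub> n = b [^]\<^bsub>M\<^esub> n" if "b \<in> carrier M" for b
  proof (induction n)
    case (Suc n)
    have "b [^]\<^bsub>opposite_monoid M\<^esub> Suc n = b \<otimes>\<^bsub>M\<^esub> b [^]\<^bsub>M\<^esub> n" using Suc by simp
    also have "\<dots> = b [^]\<^bsub>M\<^esub> Suc n" using nat_pow_Suc2[OF that] by simp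
    finally show ?case .
  qed simp
  have c: "omega_lhs M n a y x j \<in> carrier M" "omega_rhs M n a y x j \<in> carrier M" for j
    using omega_closed[of M a y x] assms by auto
  show l: "omega_lhs (opposite_monoid M) n a x y j = omega_lhs M n a y x j" for j
    by (induction j) (simp_all add: p c assms m_assoc)
  show "omega_rhs (opposite_monoid M) n a x y j = omega_rhs M n a y x j"
    by (induction j) (simp_all add: p c assms m_assoc l)
qed

lemma satisfies_opposite:
  assumes "monoid M" "satisfies j M"
  shows "satisfies j (opposite_monoid M)"
proof -
  obtain n where n: "n > 0" and eq: "\<And>k a x y. k > 0 \<Longrightarrow> a \<in> carrier M \<Longrightarrow> (\<And>i. x i \<in> carrier M) \<Longrightarrow>
      (\<And>i. y i \<in> carrier M) \<Longrightarrow> omega_lhs M (n * k) a x y j = omega_rhs M (n * k) a x y j"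
    using assms(2) unfolding satisfies_def by metis
  show ?thesis
    unfolding satisfies_def using n assms(1) by (auto intro!: exI[of _ n] simp: omega_opposite eq)
qed

section \<open>The identities define varieties\<close>

lemma satisfies_sub:
  assumes N: "satisfies j N" and M: "monoid M" and f: "f \<in> monoid_homs M N" "inj_on f (carrier M)"
  shows "satisfies j M"
proof -
  obtain n where n: "n > 0" and eq: "\<And>k a x y. k > 0 \<Longrightarrow> a \<in> carrier N \<Longrightarrow> (\<And>i. x i \<in> carrier N) \<Longrightarrow>
      (\<And>i. y i \<in> carrier N) \<Longrightarrow> omega_lhs N (n * k) a x y j = omega_rhs N (n * k) a x y j"
    using N unfolding satisfies_def by metis
  have "omega_lhs M (n * k) a x y j = omega_rhs M (n * k) a x y j"
    if k: "k > 0" and c: "a \<in> carrier M" "\<And>i. x i \<in> carrier M" "\<And>i. y i \<in> carrier M" for k a x y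
  proof (rule inj_onD[OF f(2)])
    show "f (omega_lhs M (n * k) a x y j) = f (omega_rhs M (n * k) a x y j)"
      using k c monoid_homsD(1)[OF f(1)] by (simp add: omega_hom[OF M f(1) c] eq)
  qed (use omega_closed[OF M c] in auto)
  then show ?thesis unfolding satisfies_def using n by blast
qed

lemma satisfies_epi:
  assumes M: "satisfies j M" "monoid M" and N: "monoid N" and f: "f \<in> epi M N"
  shows "satisfies j N"
proof -
  obtain n where n: "n > 0" and eq: "\<And>k a x y. k > 0 \<Longrightarrow> a \<in> carrier M \<Longrightarrow> (\<And>i. x i \<in> carrier M) \<Longrightarrow>
      (\<And>i. y i \<in> carrier M) \<Longrightarrow> omega_lhs M (n * k) a x y j = omega_rhs M (n * k) a x y j"
    using M unfolding satisfies_def by metis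
  define g where "g y = (SOME x. x \<in> carrier M \<and> f x = y)" for y
  have g: "g y \<in> carrier M" "f (g y) = y" if "y \<in> carrier N" for y
    using someI_ex[of "\<lambda>x. x \<in> carrier M \<and> f x = y"] epi_surj[OF f that] unfolding g_def by blast+
  have "omega_lhs N (n * k) a x y j = omega_rhs N (n * k) a x y j"
    if k: "k > 0" and c: "a \<in> carrier N" "\<And>i. x i \<in> carrier N" "\<And>i. y i \<in> carrier N" for k a x y
  proof -
    have c': "g a \<in> carrier M" "\<And>i. g (x i) \<in> carrier M" "\<And>i. g (y i) \<in> carrier M"
      using c g by auto
    show ?thesis
      using omega_hom[OF M(2) epi_monoid_homs[OF M(2) N f], of "g a" "\<lambda>i. g (x i)" "\<lambda>i. g (y i)" "n * k" j]
        eq[OF k c'] c c' g by simp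
  qed
  then show ?thesis unfolding satisfies_def using n by blast
qed

lemma satisfies_product:
  assumes sat: "\<And>i. i < l \<Longrightarrow> satisfies j (M i)" and M: "\<And>i. i < l \<Longrightarrow> monoid (M i)"
  shows "satisfies j (product_group {..<l::nat} M)"
proof -
  let ?P = "product_group {..<l} M"
  have mP: "monoid ?P" using M by (intro monoid_product_group) auto
  obtain n where n: "\<And>i. i < l \<Longrightarrow> n i > 0" and eq: "\<And>i k a x y. i < l \<Longrightarrow> k > 0 \<Longrightarrow> a \<in> carrier (M i) \<Longrightarrow>
      (\<And>i'. x i' \<in> carrier (M i)) \<Longrightarrow> (\<And>i'. y i' \<in> carrier (M i)) \<Longrightarrow>
      omega_lhs (M i) (n i * k) a x y j = omega_rhs (M i) (n i * k) a x y j"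
    using sat unfolding satisfies_def by metis
  \<comment> \<open>Every multiple of this product is a multiple of each \<open>n i\<close>, so one
    exponent serves all factors.\<close>
  define N where "N = (\<Prod>i<l. n i)"
  have N: "N > 0" unfolding N_def using n by (simp add: prod_pos)
  have "omega_lhs ?P (N * k) a x y j = omega_rhs ?P (N * k) a x y j"
    if k: "k > 0" and c: "a \<in> carrier ?P" "\<And>i. x i \<in> carrier ?P" "\<And>i. y i \<in> carrier ?P" for k a x y
  proof (rule ext)
    fix i
    show "omega_lhs ?P (N * k) a x y j i = omega_rhs ?P (N * k) a x y j i"
    proof (cases "i < l")
      case True
      have "n i dvd N * k" unfolding N_def using True by (simp add: dvd_prodI)
      then obtain r where r: "N * k = n i * r" by blast
      then have "r > 0" using k N by (cases "r = 0") auto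
      have pr: "(\<lambda>z. z i) \<in> monoid_homs ?P (M i)"
        using True by (intro monoid_homsI) (auto simp: PiE_iff)
      show ?thesis
        using omega_hom[OF mP pr, of a x y, OF c, where n = "N * k" and j = j] eq[OF True \<open>r > 0\<close>, of "a i" "\<lambda>i'. x i' i" "\<lambda>i'. y i' i"]
          c monoid_homsD(1)[OF pr] by (simp add: r)
    next
      \<comment> \<open>Outside the index set both sides are \<open>undefined\<close>, by
        extensionality.\<close>
      case False
      then show ?thesis using omega_closed[OF mP, of a x y, OF c, where n = "N * k" and j = j] by (auto simp: PiE_iff extensional_def)
    qed
  qed
  then show ?thesis unfolding satisfies_def using N by blast
qed

text \<open>This bounds the join from above: once both classes satisfy the identity, so does every
  member of their join.\<close>

lemma variety_satisfies: "variety {M. fin_monoid M \<and> satisfies j M}" (is "variety ?V")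
  unfolding variety_def
proof (intro conjI ballI allI impI)
  show "?V \<subseteq> fin_monoids" by (auto simp: fin_monoids_def)
  show "M\<lparr>carrier := H\<rparr> \<in> ?V" if M: "M \<in> ?V" and H: "submonoid H M" for M H
  proof -
    have "monoid (M\<lparr>carrier := H\<rparr>)"
      using M H by (simp add: submonoid.submonoid_is_monoid)
    moreover have "finite H" "H \<subseteq> carrier M"
      using M H finite_subset by (auto simp: submonoid_def)
    moreover have "(\<lambda>x. x) \<in> monoid_homs (M\<lparr>carrier := H\<rparr>) M"
      using \<open>H \<subseteq> carrier M\<close> by (intro monoid_homsI) auto
    ultimately show ?thesis
      using M satisfies_sub[of j M "M\<lparr>carrier := H\<rparr>" "\<lambda>x. x"] by simp
  qed
  show "N \<in> ?V" if "M \<in> ?V" "N \<in> fin_monoids" "epi M N \<noteq> {}" for M N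
    using that satisfies_epi[of j M N] by (auto simp: fin_monoids_def)
  show "belongs_to (product_group {..<n} M) ?V" if M: "\<forall>i<n. M i \<in> ?V" for n :: nat and M
  proof -
    have P: "fin_monoid (product_group {..<n} M)"
      using M by (auto intro!: monoid_product_group finite_PiE)
    obtain N f where N: "N \<in> fin_monoids" and f: "f \<in> iso (product_group {..<n} M) N"
      using nat_copy[OF P] .
    have "satisfies j N"
      using satisfies_epi[OF satisfies_product[of n j M] _ _ iso_epi[OF f]] M N P
      by (simp add: fin_monoids_def)
    then show ?thesis using N f by (auto simp: belongs_to_def is_iso_def fin_monoids_def)
  qed
qed

text \<open>\<open>cancel\<close> isolates what the passage to the next level requires, so that
  \<R>-triviality and \<open>\<sim>\<^sub>K\<close> can both supply it.\<close>

lemma omega_Suc_eq: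
  assumes M: "monoid M" and c: "a \<in> carrier M" "\<And>i. x i \<in> carrier M" "\<And>i. y i \<in> carrier M"
    and "n > 0"
    and idem: "\<And>z. z \<in> carrier M \<Longrightarrow> z [^]\<^bsub>M\<^esub> n \<otimes>\<^bsub>M\<^esub> z [^]\<^bsub>M\<^esub> n = z [^]\<^bsub>M\<^esub> n"
    and cancel: "\<And>e w. e \<in> carrier M \<Longrightarrow> e \<otimes>\<^bsub>M\<^esub> e = e \<Longrightarrow> w \<in> carrier M \<Longrightarrow>
      e \<otimes>\<^bsub>M\<^esub> omega_lhs M n a x y j \<otimes>\<^bsub>M\<^esub> w = e \<Longrightarrow>
      e \<otimes>\<^bsub>M\<^esub> omega_lhs M n a x y j = e \<otimes>\<^bsub>M\<^esub> omega_rhs M n a x y j"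
  shows "omega_lhs M n a x y (Suc j) = omega_rhs M n a x y (Suc j)"
proof -
  interpret monoid M by fact
  let ?u = "omega_lhs M n a x y j"
  let ?e = "(?u \<otimes>\<^bsub>M\<^esub> x j) [^]\<^bsub>M\<^esub> n"
  obtain k where k: "n = Suc k" using \<open>n > 0\<close> by (cases n) auto
  have u: "?u \<in> carrier M" by (intro omega_closed[OF M] c)
  have e: "?e \<in> carrier M" using u c by simp
  have "?e = ?u \<otimes>\<^bsub>M\<^esub> x j \<otimes>\<^bsub>M\<^esub> (?u \<otimes>\<^bsub>M\<^esub> x j) [^]\<^bsub>M\<^esub> k"
    unfolding k using nat_pow_Suc2[of "?u \<otimes>\<^bsub>M\<^esub> x j" k] u c k by simp
  \<comment> \<open>One factor \<open>u x\<close> is split off the power \<open>e\<close>; the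
    remainder, preceded by \<open>x\<close>, is the element that leads from \<open>e u\<close> back
    to \<open>e e = e\<close>.\<close>
  then have "?e \<otimes>\<^bsub>M\<^esub> ?u \<otimes>\<^bsub>M\<^esub> (x j \<otimes>\<^bsub>M\<^esub> (?u \<otimes>\<^bsub>M\<^esub> x j) [^]\<^bsub>M\<^esub> k) = ?e \<otimes>\<^bsub>M\<^esub> ?e"
    using u c e by (simp add: m_assoc)
  also have "\<dots> = ?e" using idem u c by simp
  finally have "?e \<otimes>\<^bsub>M\<^esub> ?u = ?e \<otimes>\<^bsub>M\<^esub> omega_rhs M n a x y j"
    using cancel[of ?e "x j \<otimes>\<^bsub>M\<^esub> (?u \<otimes>\<^bsub>M\<^esub> x j) [^]\<^bsub>M\<^esub> k"] e idem u c by simp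
  then show ?thesis by simp
qed

text \<open>At index 0 the sides are \<open>a\<close> and the unit, so \<open>cancel\<close> says
  that \<open>e a w = e\<close> implies \<open>e a = e\<close>, which is \<R>-triviality.\<close>

lemma R_trivial_satisfies:
  assumes M: "fin_monoid M" "R_trivial M"
  shows "satisfies (Suc 0) M"
proof -
  interpret monoid M using M by simp
  obtain n :: nat where n: "n > 0" and idem: "\<forall>z\<in>carrier M. \<forall>k>0.
      z [^]\<^bsub>M\<^esub> (n * k) \<otimes>\<^bsub>M\<^esub> z [^]\<^bsub>M\<^esub> (n * k) = z [^]\<^bsub>M\<^esub> (n * k)"
    using common_exponent[OF conjunct2[OF M(1)]] by (elim exE conjE)
  have "omega_lhs M (n * k) a x y (Suc 0) = omega_rhs M (n * k) a x y (Suc 0)"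
    if k: "k > 0" and c: "a \<in> carrier M" "\<And>i. x i \<in> carrier M" "\<And>i. y i \<in> carrier M" for k a x y
  proof (rule omega_Suc_eq[OF monoid_axioms c])
    show "n * k > 0" using n k by simp
    show "z [^]\<^bsub>M\<^esub> (n * k) \<otimes>\<^bsub>M\<^esub> z [^]\<^bsub>M\<^esub> (n * k) = z [^]\<^bsub>M\<^esub> (n * k)" if "z \<in> carrier M" for z
      using idem that k by blast
    show "e \<otimes>\<^bsub>M\<^esub> omega_lhs M (n * k) a x y 0 = e \<otimes>\<^bsub>M\<^esub> omega_rhs M (n * k) a x y 0"
      if "e \<in> carrier M" "w \<in> carrier M" "e \<otimes>\<^bsub>M\<^esub> omega_lhs M (n * k) a x y 0 \<otimes>\<^bsub>M\<^esub> w = e" for e w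
      using R_trivialD[OF M(2) that(1) c(1) that(2)] that by simp
  qed
  then show ?thesis unfolding satisfies_def using n by blast
qed

text \<open>The factor \<open>n\<close> of the exponent makes powers in \<open>M\<close> idempotent
  and the factor \<open>n'\<close> makes the identity hold in \<open>Q\<close>. Equal images in
  \<open>Q\<close> put the two sides in relation \<open>\<sim>\<^sub>K\<close>, as
  \<open>cancel\<close> requires.\<close>

lemma K_malcev_satisfies:
  assumes V: "variety V" and sat: "\<And>Q. Q \<in> V \<Longrightarrow> satisfies j Q" and M: "M \<in> K_malcev V"
  shows "satisfies (Suc j) M"
proof -
  have fM: "fin_monoid M" using M by (simp add: K_malcev_def fin_monoids_def)
  interpret monoid M using fM by simp
  obtain Q \<psi> where Q: "Q \<in> V" and \<psi>: "\<psi> \<in> monoid_homs M Q"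
    and ker: "\<And>a b. a \<in> carrier M \<Longrightarrow> b \<in> carrier M \<Longrightarrow> \<psi> a = \<psi> b \<Longrightarrow> (a, b) \<in> sim_K M"
    using K_malcevE[OF V fM belongs_to_refl[OF M]] by metis
  obtain n :: nat where n: "n > 0" and idem: "\<forall>z\<in>carrier M. \<forall>k>0.
      z [^]\<^bsub>M\<^esub> (n * k) \<otimes>\<^bsub>M\<^esub> z [^]\<^bsub>M\<^esub> (n * k) = z [^]\<^bsub>M\<^esub> (n * k)"
    using common_exponent[OF conjunct2[OF fM]] by (elim exE conjE)
  obtain n' where n': "n' > 0" and eq: "\<And>k a x y. k > 0 \<Longrightarrow> a \<in> carrier Q \<Longrightarrow> (\<And>i. x i \<in> carrier Q) \<Longrightarrow>
      (\<And>i. y i \<in> carrier Q) \<Longrightarrow> omega_lhs Q (n' * k) a x y j = omega_rhs Q (n' * k) a x y j"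
    using sat[OF Q] unfolding satisfies_def by metis
  have "omega_lhs M (n * n' * k) a x y (Suc j) = omega_rhs M (n * n' * k) a x y (Suc j)"
    if k: "k > 0" and c: "a \<in> carrier M" "\<And>i. x i \<in> carrier M" "\<And>i. y i \<in> carrier M" for k a x y
  proof (rule omega_Suc_eq[OF monoid_axioms c])
    show "n * n' * k > 0" using n n' k by simp
    show "z [^]\<^bsub>M\<^esub> (n * n' * k) \<otimes>\<^bsub>M\<^esub> z [^]\<^bsub>M\<^esub> (n * n' * k) = z [^]\<^bsub>M\<^esub> (n * n' * k)" if "z \<in> carrier M" for z
      using bspec[OF idem that, THEN spec, of "n' * k"] n' k by (simp add: mult.assoc)
    have "\<psi> (omega_lhs M (n' * (n * k)) a x y j) = \<psi> (omega_rhs M (n' * (n * k)) a x y j)"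
      unfolding omega_hom[OF monoid_axioms \<psi>, of a x y, OF c]
      using n k c monoid_homsD(1)[OF \<psi>] by (intro eq) simp_all
    moreover have "n' * (n * k) = n * n' * k" by simp
    ultimately have "\<psi> (omega_lhs M (n * n' * k) a x y j) = \<psi> (omega_rhs M (n * n' * k) a x y j)"
      by metis
    then have sim: "(omega_lhs M (n * n' * k) a x y j, omega_rhs M (n * n' * k) a x y j) \<in> sim_K M"
      by (intro ker omega_closed[OF monoid_axioms] c)
    show "e \<otimes>\<^bsub>M\<^esub> omega_lhs M (n * n' * k) a x y j = e \<otimes>\<^bsub>M\<^esub> omega_rhs M (n * n' * k) a x y j"
      if "e \<in> carrier M" "e \<otimes>\<^bsub>M\<^esub> e = e" "w \<in> carrier M"
        "e \<otimes>\<^bsub>M\<^esub> omega_lhs M (n * n' * k) a x y j \<otimes>\<^bsub>M\<^esub> w = e" for e w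
      using sim_K_cancel[OF monoid_axioms sim that(1,3,2)] that(4) by blast
  qed
  moreover have "n * n' > 0" using n n' by simp
  ultimately show ?thesis unfolding satisfies_def by blast
qed

text \<open>Each level applies \<open>K_malcev\<close> to the opposites of the previous one;
  self-duality of the identities absorbs the opposites.\<close>

lemma TW_R_satisfies: "M \<in> TW_R (Suc (Suc k)) \<Longrightarrow> satisfies (Suc k) M"
proof (induction k arbitrary: M)
  case 0
  then show ?case by (simp add: R_trivial_monoids_iff R_trivial_satisfies)
next
  case (Suc k)
  have "satisfies (Suc k) Q" if Q: "Q \<in> opposite_class (TW_R (Suc (Suc k)))" for Q
  proof -
    have "satisfies (Suc k) (opposite_monoid Q)" using Q Suc.IH by simp
    moreover have "monoid (opposite_monoid Q)"
      using Q variety_fin_monoid[OF variety_TW_R] by (simp only: in_opposite_class)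
    ultimately show ?thesis using satisfies_opposite[of "opposite_monoid Q"] by simp
  qed
  then show ?case
    using K_malcev_satisfies[OF variety_opposite_class[OF variety_TW_R]] Suc.prems
    unfolding TW_R_Suc by blast
qed

section \<open>Separating monoids\<close>

text \<open>Elements describe words over \<open>M\<close> and two new letters \<open>x\<close>, \<open>y\<close>: \<open>Mid m\<close> contains neither,
  \<open>XS m\<close> contains \<open>x\<close> but not \<open>y\<close> and has value \<open>m\<close> after its last \<open>x\<close>, \<open>PY m\<close> contains \<open>y\<close> but
  not \<open>x\<close> and has value \<open>m\<close> before its first \<open>y\<close>, \<open>XY m\<close> has every \<open>x\<close> before every \<open>y\<close> and
  value \<open>m\<close> in between, and \<open>Bad\<close> has some \<open>y\<close> before some \<open>x\<close>. The flags say whether the value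
  is recorded after \<open>x\<close> and before \<open>y\<close>, respectively.\<close>

datatype 'a marked = Mid 'a | XS 'a | PY 'a | XY 'a | Bad

text \<open>Forgetting a value means replacing it by the unit, so one datatype serves all settings
  of the flags.\<close>

definition keep :: "'a monoid \<Rightarrow> bool \<Rightarrow> 'a \<Rightarrow> 'a" where
  "keep M a m = (if a then m else \<one>\<^bsub>M\<^esub>)"

text \<open>The final equation covers the products with a factor \<open>Bad\<close> or with some
  \<open>y\<close> left of some \<open>x\<close>. A value in \<open>XY\<close> combines one recorded
  after \<open>x\<close> with one recorded before \<open>y\<close>, hence needs both flags.\<close>

fun marked_mult :: "'a monoid \<Rightarrow> bool \<Rightarrow> bool \<Rightarrow> 'a marked \<Rightarrow> 'a marked \<Rightarrow> 'a marked" where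
  "marked_mult M a b (Mid m) (Mid n) = Mid (m \<otimes>\<^bsub>M\<^esub> n)"
| "marked_mult M a b (Mid m) (XS n) = XS n"
| "marked_mult M a b (Mid m) (PY n) = PY (keep M b (m \<otimes>\<^bsub>M\<^esub> n))"
| "marked_mult M a b (Mid m) (XY n) = XY n"
| "marked_mult M a b (XS m) (Mid n) = XS (keep M a (m \<otimes>\<^bsub>M\<^esub> n))"
| "marked_mult M a b (XS m) (XS n) = XS n"
| "marked_mult M a b (XS m) (PY n) = XY (keep M (a \<and> b) (m \<otimes>\<^bsub>M\<^esub> n))"
| "marked_mult M a b (XS m) (XY n) = XY n"
| "marked_mult M a b (PY m) (Mid n) = PY m"
| "marked_mult M a b (PY m) (PY n) = PY m"
| "marked_mult M a b (XY m) (Mid n) = XY m"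
| "marked_mult M a b (XY m) (PY n) = XY m"
| "marked_mult M a b s t = Bad"

text \<open>Fields that are not recorded are pinned to the unit, so that each element has only one
  representation.\<close>

definition marked :: "'a monoid \<Rightarrow> bool \<Rightarrow> bool \<Rightarrow> 'a marked monoid" where
  "marked M a b = \<lparr>carrier = {t. case t of Mid m \<Rightarrow> m \<in> carrier M
      | XS m \<Rightarrow> m \<in> carrier M \<and> (a \<or> m = \<one>\<^bsub>M\<^esub>) | PY m \<Rightarrow> m \<in> carrier M \<and> (b \<or> m = \<one>\<^bsub>M\<^esub>)
      | XY m \<Rightarrow> m \<in> carrier M \<and> (a \<and> b \<or> m = \<one>\<^bsub>M\<^esub>) | Bad \<Rightarrow> True},
    mult = marked_mult M a b, one = Mid \<one>\<^bsub>M\<^esub>\<rparr>"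

lemma marked_simps [simp]:
  "mult (marked M a b) = marked_mult M a b"
  "one (marked M a b) = Mid \<one>\<^bsub>M\<^esub>"
  "Mid m \<in> carrier (marked M a b) \<longleftrightarrow> m \<in> carrier M"
  "XS m \<in> carrier (marked M a b) \<longleftrightarrow> m \<in> carrier M \<and> (a \<or> m = \<one>\<^bsub>M\<^esub>)"
  "PY m \<in> carrier (marked M a b) \<longleftrightarrow> m \<in> carrier M \<and> (b \<or> m = \<one>\<^bsub>M\<^esub>)"
  "XY m \<in> carrier (marked M a b) \<longleftrightarrow> m \<in> carrier M \<and> (a \<and> b \<or> m = \<one>\<^bsub>M\<^esub>)"
  "Bad \<in> carrier (marked M a b)"
  by (simp_all add: marked_def)

lemma fin_monoid_marked:
  assumes M: "fin_monoid M"
  shows "fin_monoid (marked M a b)"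
proof
  interpret monoid M using M by simp
  show "monoid (marked M a b)"
  proof (rule monoidI)
    show "\<one>\<^bsub>marked M a b\<^esub> \<in> carrier (marked M a b)" by simp
    fix r s t assume *: "r \<in> carrier (marked M a b)" "s \<in> carrier (marked M a b)" "t \<in> carrier (marked M a b)"
    show "r \<otimes>\<^bsub>marked M a b\<^esub> s \<in> carrier (marked M a b)"
      using * by (cases r; cases s) (auto simp: keep_def)
    show "r \<otimes>\<^bsub>marked M a b\<^esub> s \<otimes>\<^bsub>marked M a b\<^esub> t = r \<otimes>\<^bsub>marked M a b\<^esub> (s \<otimes>\<^bsub>marked M a b\<^esub> t)"
      using * by (cases r; cases s; cases t) (auto simp: keep_def m_assoc)
    show "\<one>\<^bsub>marked M a b\<^esub> \<otimes>\<^bsub>marked M a b\<^esub> r = r" "r \<otimes>\<^bsub>marked M a b\<^esub> \<one>\<^bsub>marked M a b\<^esub> = r"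
      using * by (cases r; auto simp: keep_def)+
  qed
  have "carrier (marked M a b) \<subseteq> Mid ` carrier M \<union> XS ` carrier M \<union> PY ` carrier M \<union> XY ` carrier M \<union> {Bad}"
  proof
    fix t assume "t \<in> carrier (marked M a b)"
    then show "t \<in> Mid ` carrier M \<union> XS ` carrier M \<union> PY ` carrier M \<union> XY ` carrier M \<union> {Bad}"
      by (cases t) auto
  qed
  moreover have "finite (Mid ` carrier M \<union> XS ` carrier M \<union> PY ` carrier M \<union> XY ` carrier M \<union> {Bad})"
    using M by simp
  ultimately show "finite (carrier (marked M a b))" by (rule finite_subset)
qed

primrec flip :: "'a marked \<Rightarrow> 'a marked" where
  "flip (Mid m) = Mid m"
| "flip (XS m) = PY m"
| "flip (PY m) = XS m"
| "flip (XY m) = XY m"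
| "flip Bad = Bad"

text \<open>Reversing a word and exchanging \<open>x\<close> with \<open>y\<close> turns the value
  after the last \<open>x\<close> into the value before the first \<open>y\<close>; hence the flags
  change places.\<close>

lemma marked_opposite: "opposite_monoid (marked M a b) \<cong> marked (opposite_monoid M) b a"
proof (rule is_isoI)
  have ff: "flip (flip t) = t" for t :: "'a marked" by (cases t) auto
  \<comment> \<open>Stated for an arbitrary pair of monoids, as it is needed in both directions of
    the bijection.\<close>
  have fc: "flip t \<in> carrier (marked N b a)" if "t \<in> carrier (marked M a b)"
    "carrier N = carrier M" "\<one>\<^bsub>N\<^esub> = \<one>\<^bsub>M\<^esub>" for t and M N :: "'a monoid" and a b
    using that by (cases t) auto
  have "bij_betw flip (carrier (marked M a b)) (carrier (marked (opposite_monoid M) b a))"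
    using ff fc by (intro bij_betw_byWitness[where f' = flip]) auto
  moreover have "flip (t \<otimes>\<^bsub>marked M a b\<^esub> s) = flip s \<otimes>\<^bsub>marked (opposite_monoid M) b a\<^esub> flip t" for s t
    by (cases s; cases t) (auto simp: keep_def)
  ultimately show "flip \<in> iso (opposite_monoid (marked M a b)) (marked (opposite_monoid M) b a)"
    using fc by (auto simp: iso_def hom_def bij_betw_def)
qed

text \<open>Values after \<open>x\<close> must not be recorded: \<open>XS m\<close> times
  \<open>XS n\<close> is \<open>XS n\<close>, so all these elements would be \<R>-equivalent. Values
  before \<open>y\<close> are fixed once \<open>y\<close> has been read.\<close>

lemma marked_R_trivial:
  assumes M: "monoid M" "R_trivial M"
  shows "R_trivial (marked M False b)"
  unfolding R_trivial_def
proof (intro ballI impI)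
  fix x s t assume *: "x \<in> carrier (marked M False b)" "s \<in> carrier (marked M False b)"
    "t \<in> carrier (marked M False b)"
    and eq: "x \<otimes>\<^bsub>marked M False b\<^esub> s \<otimes>\<^bsub>marked M False b\<^esub> t = x"
  show "x \<otimes>\<^bsub>marked M False b\<^esub> s = x"
    using * eq R_trivialD[OF M(2)] by (cases x; cases s; cases t) (auto simp: keep_def)
qed

primrec marked_map :: "('a \<Rightarrow> 'b) \<Rightarrow> 'b monoid \<Rightarrow> bool \<Rightarrow> bool \<Rightarrow> 'a marked \<Rightarrow> 'b marked" where
  "marked_map f N a b (Mid m) = Mid (f m)"
| "marked_map f N a b (XS m) = XS (keep N a (f m))"
| "marked_map f N a b (PY m) = PY (keep N b (f m))"
| "marked_map f N a b (XY m) = XY (keep N (a \<and> b) (f m))"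
| "marked_map f N a b Bad = Bad"

lemma marked_map_hom:
  assumes M: "monoid M" and N: "monoid N" and f: "f \<in> monoid_homs M N" and "a' \<longrightarrow> a" "b' \<longrightarrow> b"
  shows "marked_map f N a' b' \<in> monoid_homs (marked M a b) (marked N a' b')"
proof (rule monoid_homsI)
  interpret M: monoid M by fact
  interpret N: monoid N by fact
  note hom = monoid_homsD[OF f]
  fix s t assume *: "s \<in> carrier (marked M a b)" "t \<in> carrier (marked M a b)"
  show "marked_map f N a' b' s \<in> carrier (marked N a' b')"
    using * by (cases s) (auto simp: keep_def hom)
  show "marked_map f N a' b' (s \<otimes>\<^bsub>marked M a b\<^esub> t)
      = marked_map f N a' b' s \<otimes>\<^bsub>marked N a' b'\<^esub> marked_map f N a' b' t"
    using * assms(4,5) by (cases s; cases t) (auto simp: keep_def hom)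
next
  show "marked_map f N a' b' \<one>\<^bsub>marked M a b\<^esub> = \<one>\<^bsub>marked N a' b'\<^esub>"
    using monoid_homsD(3)[OF f] by simp
qed

text \<open>Forgetting the values before \<open>y\<close> stays within \<open>\<sim>\<^sub>K\<close>: no product with \<open>y\<close> in its right factor
  returns to the \<open>\<R>\<close>-class of an idempotent without \<open>y\<close>.\<close>

lemma marked_map_sim_K:
  assumes M: "fin_monoid M" and ker: "\<And>m n. m \<in> carrier M \<Longrightarrow> n \<in> carrier M \<Longrightarrow> f m = f n \<Longrightarrow> (m, n) \<in> sim_K M"
    and inj: "a \<Longrightarrow> inj_on f (carrier M)"
    and s: "s \<in> carrier (marked M a b)" and t: "t \<in> carrier (marked M a b)"
    and eq: "marked_map f N a False s = marked_map f N a False t"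
  shows "(s, t) \<in> sim_K (marked M a b)"
proof -
  let ?T = "marked M a b"
  have T: "monoid ?T" using fin_monoid_marked[OF M] by blast
  have mM: "monoid M" using M by simp
  have key: "e \<otimes>\<^bsub>?T\<^esub> s = e \<otimes>\<^bsub>?T\<^esub> t"
    if s: "s \<in> carrier ?T" and t: "t \<in> carrier ?T"
      and eq: "marked_map f N a False s = marked_map f N a False t"
      and e: "e \<in> carrier ?T" "e \<otimes>\<^bsub>?T\<^esub> e = e" and w: "w \<in> carrier ?T" "e \<otimes>\<^bsub>?T\<^esub> s \<otimes>\<^bsub>?T\<^esub> w = e" for s t e w
  proof (cases s)
    case (Mid m)
    then obtain n where n: "t = Mid n" "f m = f n" using eq by (cases t) auto
    have mn: "m \<in> carrier M" "n \<in> carrier M" using s t Mid n by auto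
    \<comment> \<open>This settles \<open>e = XS g\<close>, whose product with \<open>Mid m\<close>
      records \<open>m\<close> when the flag is on.\<close>
    have "m = n" if a using inj_onD[OF inj[OF that] n(2) mn] .
    moreover have "g \<otimes>\<^bsub>M\<^esub> m = g \<otimes>\<^bsub>M\<^esub> n" if g: "e = Mid g" for g
    proof -
      \<comment> \<open>No product containing \<open>x\<close> or \<open>y\<close> returns to
        \<open>Mid g\<close>, so the witness comes from \<open>M\<close>.\<close>
      obtain v where v: "w = Mid v" using w(2) g Mid by (cases w) auto
      show ?thesis
        using sim_K_cancel[OF mM ker[OF mn n(2)], of g v] e w v g Mid by auto
    qed
    ultimately show ?thesis using Mid n by (cases e) (auto simp: keep_def)
  next
    case (XS m)
    then obtain n where n: "t = XS n" "keep N a (f m) = keep N a (f n)" using eq by (cases t) auto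
    have "m = n"
      using s t XS n inj_onD[OF inj, of m n] by (cases a) (auto simp: keep_def)
    then show ?thesis using XS n by simp
  next
    case (PY m)
    then obtain n where "t = PY n" using eq by (cases t) auto
    \<comment> \<open>If \<open>e\<close> contains no \<open>y\<close>, then \<open>e s\<close> does
      and no \<open>w\<close> leads back; otherwise the value carried by the right factor is not
      read.\<close>
    then show ?thesis using PY e w by (cases e; cases w) auto
  next
    case (XY m)
    then obtain n where "t = XY n" using eq by (cases t) auto
    then show ?thesis using XY e w by (cases e; cases w) auto
  next
    case Bad
    then show ?thesis using eq by (cases t) auto
  qed
  show ?thesis
    unfolding sim_K_witness[OF T s t]
    using key[OF s t eq] key[OF t s eq[symmetric]] by metis
qed

section \<open>Levels of the marked monoids\<close>

lemma belongs_to_marked_trivial: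
  "belongs_to (marked (inter_monoid ({} :: nat set)) False False) R_trivial_monoids"
proof (rule belongs_to_R_trivial)
  show "fin_monoid (marked (inter_monoid ({} :: nat set)) False False)"
    by (intro fin_monoid_marked fin_monoid_inter) simp
  show "R_trivial (marked (inter_monoid ({} :: nat set)) False False)"
    using fin_monoid_inter[of "{} :: nat set"] by (intro marked_R_trivial R_trivial_inter) simp
qed

lemma belongs_to_iso:
  assumes "M \<cong> N" "belongs_to N V"
  shows "belongs_to M V"
  using assms iso_trans unfolding belongs_to_def by blast

lemma belongs_to_marked_trivial_opposite:
  "belongs_to (marked (inter_monoid ({} :: nat set)) False False) (opposite_class R_trivial_monoids)"
  unfolding belongs_to_opposite_class
  by (rule belongs_to_iso[OF marked_opposite]) (simp only: opposite_inter belongs_to_marked_trivial)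

text \<open>With nothing recorded, \<open>marked M\<close> is a quotient of the product of \<open>M\<close> with its instance over
  the trivial monoid.\<close>

lemma belongs_to_marked_FF:
  fixes M :: "'a monoid"
  assumes V: "variety V" and M: "fin_monoid M" "belongs_to M V"
    and triv: "belongs_to (marked (inter_monoid ({} :: nat set)) False False) V"
  shows "belongs_to (marked M False False) V"
proof -
  interpret monoid M using M by simp
  let ?E = "marked (inter_monoid ({} :: nat set)) False False" and ?T = "marked M False False"
  have E: "monoid ?E" using fin_monoid_marked[OF fin_monoid_inter[of "{} :: nat set"]] by simp
  have S: "monoid (M \<times>\<times> ?E)" using DirProd_monoid[OF monoid_axioms E] .
  define \<phi> :: "'a \<times> nat set marked \<Rightarrow> 'a marked" where
    "\<phi> p = (case snd p of Mid _ \<Rightarrow> Mid (fst p) | XS _ \<Rightarrow> XS \<one>\<^bsub>M\<^esub> | PY _ \<Rightarrow> PY \<one>\<^bsub>M\<^esub> | XY _ \<Rightarrow> XY \<one>\<^bsub>M\<^esub> | Bad \<Rightarrow> Bad)" for p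
  have "\<phi> \<in> monoid_homs (M \<times>\<times> ?E) ?T"
  proof (rule monoid_homsI)
    fix p q assume "p \<in> carrier (M \<times>\<times> ?E)" "q \<in> carrier (M \<times>\<times> ?E)"
    then show "\<phi> p \<in> carrier ?T" "\<phi> (p \<otimes>\<^bsub>M \<times>\<times> ?E\<^esub> q) = \<phi> p \<otimes>\<^bsub>?T\<^esub> \<phi> q"
      by (cases p; cases q; cases "snd p"; cases "snd q"; auto simp: \<phi>_def keep_def)+
  next
    show "\<phi> \<one>\<^bsub>M \<times>\<times> ?E\<^esub> = \<one>\<^bsub>?T\<^esub>" by (simp add: \<phi>_def)
  qed
  moreover have "\<exists>p\<in>carrier (M \<times>\<times> ?E). \<phi> p = t" if "t \<in> carrier ?T" for t
  proof (cases t)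
    case (Mid m)
    then show ?thesis
      using that by (intro bexI[of _ "(m, Mid {})"]) (auto simp: \<phi>_def inter_monoid_def)
  next
    case (XS m)
    then show ?thesis
      using that by (intro bexI[of _ "(\<one>\<^bsub>M\<^esub>, XS {})"]) (auto simp: \<phi>_def inter_monoid_def)
  next
    case (PY m)
    then show ?thesis
      using that by (intro bexI[of _ "(\<one>\<^bsub>M\<^esub>, PY {})"]) (auto simp: \<phi>_def inter_monoid_def)
  next
    case (XY m)
    then show ?thesis
      using that by (intro bexI[of _ "(\<one>\<^bsub>M\<^esub>, XY {})"]) (auto simp: \<phi>_def inter_monoid_def)
  next
    case Bad
    then show ?thesis by (intro bexI[of _ "(\<one>\<^bsub>M\<^esub>, Bad)"]) (auto simp: \<phi>_def)
  qed
  ultimately have \<phi>: "\<phi> \<in> epi (M \<times>\<times> ?E) ?T" by (rule epiI)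
  have "fst \<in> monoid_homs (M \<times>\<times> ?E) M" "snd \<in> monoid_homs (M \<times>\<times> ?E) ?E"
    by (auto intro!: monoid_homsI simp: DirProd_def)
  from variety_divisor_product[OF V M(2) monoid_axioms triv E S this \<phi> fin_monoid_marked[OF M(1)]]
  show ?thesis by (auto simp: prod_eq_iff)
qed

text \<open>This five-element monoid remembers only which of \<open>x\<close> and \<open>y\<close>
  occur and whether some \<open>y\<close> precedes some \<open>x\<close>. It is both an auxiliary
  factor at every level and the first separating monoid.\<close>

lemma marked_trivial_TW_R:
  "belongs_to (marked (inter_monoid ({} :: nat set)) False False) (TW_R (Suc (Suc k)))"
  "belongs_to (marked (inter_monoid ({} :: nat set)) False False) (opposite_class (TW_R (Suc (Suc k))))"
  using belongs_to_mono[OF R_trivial_le_TW_R belongs_to_marked_trivial]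
    belongs_to_mono[OF opposite_class_mono[OF R_trivial_le_TW_R] belongs_to_marked_trivial_opposite] by auto

text \<open>Recording values before \<open>y\<close> costs no level. At the bottom this is
  \<R>-triviality; higher up these values may be forgotten within \<open>\<sim>\<^sub>K\<close>,
  which leaves \<open>marked Q False False\<close>, a member of the class of
  \<open>Q\<close>.\<close>

lemma belongs_to_marked_FT:
  assumes M: "fin_monoid M" "belongs_to M (TW_R (Suc (Suc k)))"
  shows "belongs_to (marked M False True) (TW_R (Suc (Suc k)))"
proof (cases k)
  case 0
  obtain N f where N: "N \<in> R_trivial_monoids" and f: "f \<in> iso M N"
    using M(2) 0 by (auto simp: belongs_to_def is_iso_def)
  have "f \<in> monoid_homs M N"
    using M N by (intro epi_monoid_homs iso_epi[OF f]) (auto simp: R_trivial_monoids_iff)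
  then have "R_trivial M"
    using R_trivial_sub[of N f M] N M f by (auto simp: R_trivial_monoids_iff iso_def bij_betw_def)
  then show ?thesis
    using 0 M belongs_to_R_trivial[OF fin_monoid_marked[OF M(1)] marked_R_trivial] by simp
next
  case (Suc l)
  let ?V = "opposite_class (TW_R (Suc (Suc l)))"
  have V: "variety ?V" by (intro variety_opposite_class variety_TW_R)
  have mM: "monoid M" using M by simp
  have "belongs_to M (K_malcev ?V)" using M(2) unfolding Suc TW_R_Suc .
  then obtain Q \<psi> where Q: "Q \<in> ?V" and \<psi>: "\<psi> \<in> monoid_homs M Q"
    and ker: "\<And>a b. a \<in> carrier M \<Longrightarrow> b \<in> carrier M \<Longrightarrow> \<psi> a = \<psi> b \<Longrightarrow> (a, b) \<in> sim_K M"
    using K_malcevE[OF V M(1)] by metis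
  have fQ: "fin_monoid Q" using variety_fin_monoid[OF V Q] .
  then have mQ: "monoid Q" by simp
  have S: "monoid (marked M False True)" and mT: "monoid (marked Q False False)"
    using fin_monoid_marked[OF M(1)] fin_monoid_marked[OF fQ] by blast+
  have "(s, t) \<in> sim_K (marked M False True)"
    if "s \<in> carrier (marked M False True)" "t \<in> carrier (marked M False True)"
      "marked_map \<psi> Q False False s = marked_map \<psi> Q False False t" for s t
    by (rule marked_map_sim_K[OF M(1) ker _ that]) auto
  then have "belongs_to (marked M False True) (K_malcev ?V)"
    by (intro K_malcevI[OF V S fin_monoid_marked[OF M(1)] id_epi marked_map_hom[OF mM mQ \<psi>] mT
          belongs_to_marked_FF[OF V fQ belongs_to_refl[OF Q] marked_trivial_TW_R(2)]]) auto
  then show ?thesis unfolding Suc TW_R_Suc .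
qed

text \<open>Recording both values costs one level: forgetting those before \<open>y\<close> within
  \<open>\<sim>\<^sub>K\<close> leaves \<open>marked M True False\<close>, which is dual to the
  instance that costs nothing.\<close>

lemma belongs_to_marked_TT:
  assumes M: "fin_monoid M" "belongs_to M (opposite_class (TW_R (Suc (Suc k))))"
  shows "belongs_to (marked M True True) (TW_R (Suc (Suc (Suc k))))"
proof -
  let ?V = "opposite_class (TW_R (Suc (Suc k)))"
  have V: "variety ?V" by (intro variety_opposite_class variety_TW_R)
  have mM: "monoid M" using M by simp
  have id: "(\<lambda>x. x) \<in> monoid_homs M M" by (intro monoid_homsI) auto
  have "belongs_to (marked (opposite_monoid M) False True) (TW_R (Suc (Suc k)))"
    using M by (intro belongs_to_marked_FT) (simp_all add: belongs_to_opposite_class)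
  then have "belongs_to (marked M True False) ?V"
    unfolding belongs_to_opposite_class by (rule belongs_to_iso[OF marked_opposite])
  moreover have "monoid (marked M True True)" "monoid (marked M True False)"
    using fin_monoid_marked[OF M(1)] by blast+
  moreover have "(s, t) \<in> sim_K (marked M True True)"
    if "s \<in> carrier (marked M True True)" "t \<in> carrier (marked M True True)"
      "marked_map (\<lambda>x. x) M True False s = marked_map (\<lambda>x. x) M True False t" for s t
    by (rule marked_map_sim_K[OF M(1) _ _ that]) (auto intro: sim_K_refl)
  ultimately have "belongs_to (marked M True True) (K_malcev ?V)"
    by (intro K_malcevI[OF V _ fin_monoid_marked[OF M(1)] id_epi marked_map_hom[OF mM mM id]]) auto
  then show ?thesis unfolding TW_R_Suc .
qed

text \<open>Fails the identity for every exponent, which is more than the negation of \<open>satisfies\<close>.\<close>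

definition refutes :: "nat \<Rightarrow> 'a monoid \<Rightarrow> bool" where
  "refutes j M \<longleftrightarrow> (\<forall>n>0. \<exists>a\<in>carrier M. \<exists>x y. (\<forall>i. x i \<in> carrier M) \<and> (\<forall>i. y i \<in> carrier M) \<and>
     omega_lhs M n a x y j \<noteq> omega_rhs M n a x y j)"

lemma refutes_not_satisfies: "refutes j M \<Longrightarrow> \<not> satisfies j M"
  unfolding refutes_def satisfies_def by (metis mult_pos_pos zero_less_one)

text \<open>Level \<open>j\<close> reads only letters with index below \<open>j\<close>, so
  \<open>x j\<close> and \<open>y j\<close> remain free for the next level.\<close>

lemma omega_cong:
  assumes "\<And>i. i < j \<Longrightarrow> x i = x' i" "\<And>i. i < j \<Longrightarrow> y i = y' i"
  shows "omega_lhs M n a x y j = omega_lhs M n a x' y' j"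
    "omega_rhs M n a x y j = omega_rhs M n a x' y' j"
proof -
  have l: "omega_lhs M n a x y k = omega_lhs M n a x' y' k" if "k \<le> j" for k
    using that assms by (induction k) auto
  then show "omega_lhs M n a x y j = omega_lhs M n a x' y' j" by simp
  have "omega_rhs M n a x y k = omega_rhs M n a x' y' k" if "k \<le> j" for k
    using that assms l by (induction k) auto
  then show "omega_rhs M n a x y j = omega_rhs M n a x' y' j" by simp
qed

text \<open>The old letters become \<open>Mid\<close> and the letters at index \<open>j\<close>
  become the new \<open>x\<close> and \<open>y\<close>. Then \<open>(U x)\<^sup>n\<close> and
  \<open>(y U)\<^sup>n\<close> collapse to \<open>XS 1\<close> and \<open>PY 1\<close>, and the two
  sides at the next level are \<open>XY u\<close> and \<open>XY v\<close> for the distinct values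
  \<open>u\<close> and \<open>v\<close> in \<open>M\<close>.\<close>

lemma marked_refutes:
  assumes M: "fin_monoid M" and ref: "refutes j M"
  shows "refutes (Suc j) (marked M True True)"
  unfolding refutes_def
proof (intro allI impI)
  fix n :: nat assume n: "n > 0"
  interpret monoid M using M by simp
  let ?T = "marked M True True"
  obtain a x y where a: "a \<in> carrier M" and x: "\<And>i. x i \<in> carrier M" and y: "\<And>i. y i \<in> carrier M"
    and neq: "omega_lhs M n a x y j \<noteq> omega_rhs M n a x y j"
    using ref n unfolding refutes_def by blast
  define X where "X i = (if i < j then Mid (x i) else XS \<one>\<^bsub>M\<^esub>)" for i
  define Y where "Y i = (if i < j then Mid (y i) else PY \<one>\<^bsub>M\<^esub>)" for i
  have mid: "Mid \<in> monoid_homs M ?T" by (intro monoid_homsI) simp_all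
  have "omega_lhs ?T n (Mid a) X Y j = Mid (omega_lhs M n a x y j)"
    "omega_rhs ?T n (Mid a) X Y j = Mid (omega_rhs M n a x y j)"
    using omega_hom[OF monoid_axioms mid, of a x y n j] a x y
      omega_cong[of j X "\<lambda>i. Mid (x i)" Y "\<lambda>i. Mid (y i)" ?T n "Mid a"] by (simp_all add: X_def Y_def)
  moreover have "XS \<one>\<^bsub>M\<^esub> [^]\<^bsub>?T\<^esub> n = XS \<one>\<^bsub>M\<^esub>"
    using n
  proof (induction n)
    case (Suc n)
    then show ?case by (cases "n = 0") simp_all
  qed simp
  moreover have "PY u [^]\<^bsub>?T\<^esub> n = PY u" if "u \<in> carrier M" for u
    using n that
  proof (induction n)
    case (Suc n)
    then show ?case by (cases "n = 0") (simp_all add: keep_def)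
  qed simp
  ultimately have "omega_lhs ?T n (Mid a) X Y (Suc j) \<noteq> omega_rhs ?T n (Mid a) X Y (Suc j)"
    using neq omega_closed[OF monoid_axioms, of a x y, OF a x y]
    by (simp add: X_def Y_def keep_def)
  then show "\<exists>a\<in>carrier ?T. \<exists>x y. (\<forall>i. x i \<in> carrier ?T) \<and> (\<forall>i. y i \<in> carrier ?T) \<and>
     omega_lhs ?T n a x y (Suc j) \<noteq> omega_rhs ?T n a x y (Suc j)"
    using a x y by (intro bexI[of _ "Mid a"] exI[of _ X] exI[of _ Y]) (auto simp: X_def Y_def)
qed

lemma refutes_iso:
  assumes "refutes j M" "monoid M" "monoid N" "f \<in> iso M N"
  shows "refutes j N"
  unfolding refutes_def
proof (intro allI impI)
  fix n :: nat assume "n > 0"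
  then obtain a x y where c: "a \<in> carrier M" "\<And>i. x i \<in> carrier M" "\<And>i. y i \<in> carrier M"
    and neq: "omega_lhs M n a x y j \<noteq> omega_rhs M n a x y j"
    using assms(1) unfolding refutes_def by blast
  have f: "f \<in> monoid_homs M N" using assms by (intro epi_monoid_homs iso_epi)
  have inj: "inj_on f (carrier M)" using assms(4) by (simp add: iso_def bij_betw_def)
  have "f (omega_lhs M n a x y j) \<noteq> f (omega_rhs M n a x y j)"
    using neq inj_onD[OF inj] omega_closed[OF assms(2), of a x y, OF c] by blast
  then show "\<exists>a\<in>carrier N. \<exists>x y. (\<forall>i. x i \<in> carrier N) \<and> (\<forall>i. y i \<in> carrier N) \<and>
     omega_lhs N n a x y j \<noteq> omega_rhs N n a x y j"
    using c monoid_homsD(1)[OF f] omega_hom[OF assms(2) f, of a x y, OF c]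
    by (intro bexI[of _ "f a"] exI[of _ "\<lambda>i. f (x i)"] exI[of _ "\<lambda>i. f (y i)"]) auto
qed

text \<open>At index 0 the identity reads \<open>a = 1\<close> and fails in any nontrivial monoid.
  In the step \<open>belongs_to_marked_TT\<close> is used twice, for \<open>M\<close> and for its
  opposite, to reach both sides of the next level.\<close>

lemma separating_monoid:
  "\<exists>M \<in> TW_R (Suc (Suc k)) \<inter> opposite_class (TW_R (Suc (Suc k))). refutes k M"
proof -
  \<comment> \<open>Marking changes the type; passing to a copy over \<open>nat\<close> keeps the
    induction within one type.\<close>
  have transfer: "\<exists>N \<in> TW_R (Suc (Suc k)) \<inter> opposite_class (TW_R (Suc (Suc k))). refutes k N"
    if M: "fin_monoid M" and bt: "belongs_to M (TW_R (Suc (Suc k)))"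
      "belongs_to M (opposite_class (TW_R (Suc (Suc k))))" and ref: "refutes k M" for M :: "'b monoid" and k
  proof -
    obtain N f where N: "N \<in> fin_monoids" and f: "f \<in> iso M N" using nat_copy[OF M] .
    have fN: "fin_monoid N" using N by (simp add: fin_monoids_def)
    obtain g where "g \<in> iso N M" using iso_inverse[of M f N] M f by blast
    then have "N \<cong> M" by (rule is_isoI)
    then have "N \<in> TW_R (Suc (Suc k))" "N \<in> opposite_class (TW_R (Suc (Suc k)))"
      using belongs_to_nat[OF variety_TW_R _ fN] belongs_to_nat[OF variety_opposite_class[OF variety_TW_R] _ fN]
        belongs_to_iso bt by blast+
    moreover have "refutes k N" using refutes_iso[OF ref _ _ f] M fN by blast
    ultimately show ?thesis by blast
  qed
  show ?thesis
  proof (induction k)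
    case 0
    let ?T = "marked (inter_monoid ({} :: nat set)) False False"
    have "refutes 0 ?T"
      unfolding refutes_def by (auto intro!: bexI[of _ Bad] exI[of _ "\<lambda>_. Bad"])
    then show ?case
      using transfer[OF _ marked_trivial_TW_R] fin_monoid_marked fin_monoid_inter[of "{} :: nat set"] by blast
  next
    case (Suc k)
    then obtain M where M: "M \<in> TW_R (Suc (Suc k))" "M \<in> opposite_class (TW_R (Suc (Suc k)))"
      and ref: "refutes k M" by blast
    have fM: "fin_monoid M" using variety_fin_monoid[OF variety_TW_R M(1)] .
    have "belongs_to (marked (opposite_monoid M) True True) (TW_R (Suc (Suc (Suc k))))"
      using fM M belongs_to_refl[OF M(1)]
      by (intro belongs_to_marked_TT) (simp_all add: belongs_to_opposite_class)
    then have "belongs_to (marked M True True) (opposite_class (TW_R (Suc (Suc (Suc k)))))"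
      unfolding belongs_to_opposite_class by (rule belongs_to_iso[OF marked_opposite])
    then show ?case
      using transfer[OF fin_monoid_marked[OF fM] _ _ marked_refutes[OF fM ref]]
        belongs_to_marked_TT[OF fM belongs_to_refl[OF M(2)]] by blast
  qed
qed

theorem theorem2:
  fixes m :: nat
  assumes "m \<ge> 2"
  shows "variety_join (TW_R m) (TW_L m) \<subset> TW_R (m + 1) \<inter> TW_L (m + 1)"
proof -
  obtain k where m: "m = Suc (Suc k)" using assms by (metis add_2_eq_Suc le_Suc_ex)
  let ?W = "\<lambda>k. TW_R (Suc (Suc k))"
  have "variety (?W (Suc k) \<inter> opposite_class (?W (Suc k)))"
    by (intro variety_Int variety_opposite_class variety_TW_R)
  \<comment> \<open>The right-hand side is itself a variety containing both classes, hence it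
    contains their join.\<close>
  then have sub: "variety_join (?W k) (opposite_class (?W k)) \<subseteq> ?W (Suc k) \<inter> opposite_class (?W (Suc k))"
    using join_le[of k] unfolding variety_join_def by blast
  have "?W k \<subseteq> {M. fin_monoid M \<and> satisfies (Suc k) M}"
    using TW_R_satisfies variety_fin_monoid[OF variety_TW_R] by blast
  moreover have "opposite_class (?W k) \<subseteq> {M. fin_monoid M \<and> satisfies (Suc k) M}"
  proof
    fix M assume M: "M \<in> opposite_class (?W k)"
    then have "satisfies (Suc k) (opposite_monoid M)" "fin_monoid (opposite_monoid M)"
      using TW_R_satisfies variety_fin_monoid[OF variety_TW_R] unfolding in_opposite_class by blast+
    then show "M \<in> {M. fin_monoid M \<and> satisfies (Suc k) M}"
      using satisfies_opposite[of "opposite_monoid M" "Suc k"] by simp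
  qed
  ultimately have "variety_join (?W k) (opposite_class (?W k)) \<subseteq> {M. fin_monoid M \<and> satisfies (Suc k) M}"
    using variety_satisfies[of "Suc k"] unfolding variety_join_def by blast
  \<comment> \<open>The indices meet here: level \<open>k\<close> satisfies the identity with index
    \<open>Suc k\<close>, which is the one refuted inside the intersection at level
    \<open>Suc k\<close>.\<close>
  moreover obtain M where "M \<in> ?W (Suc k) \<inter> opposite_class (?W (Suc k))" "refutes (Suc k) M"
    using separating_monoid by blast
  ultimately have "variety_join (?W k) (opposite_class (?W k)) \<noteq> ?W (Suc k) \<inter> opposite_class (?W (Suc k))"
    using refutes_not_satisfies by blast
  with sub have "variety_join (?W k) (opposite_class (?W k)) \<subset> ?W (Suc k) \<inter> opposite_class (?W (Suc k))"
    by (rule psubsetI)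
  then show ?thesis unfolding m by (simp only: TW_L_opposite Suc_eq_plus1[symmetric])
qed

end
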